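(* Let $G$ be a finite simple graph with independence number three, with independence polynomial $I_G(z)=1+a_1z+a_2z^2+a_3z^3$, and suppose $a_2^2>3a_1a_3$ and $a_2^2>4a_3(a_1-1)$. (1) Suppose $a_2^2<4a_1a_3$. (a) If $4a_3(a_1-1)<a_2^2<\frac{a_3(2a_1-3)^2}{a_1-2}$, then $\mathcal{A}(G)$ is disconnected but not totally disconnected. (b) If $a_2^2=\frac{a_3(2a_1-3)^2}{a_1-2}$, then $\mathcal{A}(G)$ is disconnected but not totally disconnected. (c) If $\frac{a_3(2a_1-3)^2}{a_1-2}<a_2^2<\frac{4a_3(a_1-2)^2}{a_1-3}$, then $\mathcal{A}(G)$ is disconnected but not totally disconnected. (d) If $a_2^2=\frac{4a_3(a_1-2)^2}{a_1-3}$, then $\mathcal{A}(G)$ is connected for $a_1\le 7$, and disconnected but not totally disconnected for $a_1>7$. (e) If $\frac{4a_3(a_1-2)^2}{a_1-3}<a_2^2<4a_1a_3$ and $(a_1,a_2,a_3)\notin\{(7,9,3),(8,11,4)\}$, then $\mathcal{A}(G)$ is disconnected. (2) If $a_2^2=4a_1a_3$, then $\mathcal{A}(G)$ is connected for $a_1\le 9$ and totally disconnected for $a_1>9$. (3) If $a_2^2>4a_1a_3$, then $\mathcal{A}(G)$ is disconnected.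
   Context: An independent set in a simple graph $G$ is a set of pairwise non-adjacent vertices; the independence number is the largest size of an independent set. The independence polynomial is $I_G(z)=\sum_{i=0}^{d}a_iz^i$ with $a_0=1$, where $a_i$ is the number of independent sets with exactly $i$ elements and $d$ is the independence number. The lexicographic product of $G$ with itself has vertex set $V(G)\times V(G)$, with $(a,x)$ adjacent to $(b,y)$ iff $a$ is adjacent to $b$ in $G$, or $a=b$ and $x$ is adjacent to $y$ in $G$; $G^m$ denotes the $m$-fold lexicographic product of $G$ with itself. For a polynomial $f$, $\mathrm{Roots}(f)=\{z: f(z)=0\}$. The independence attractor is $\mathcal{A}(G)=\lim_{m\to\infty}\mathrm{Roots}(I_{G^m})$ in the Hausdorff metric on compact subsets of $\mathbb{C}$. A set is totally disconnected if each of its connected components is a single point. *)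

theory Defs
  imports "HOL-Analysis.Analysis" "HOL-Computational_Algebra.Polynomial"
    "Graph_Theory.Pair_Digraph"
begin

text \<open>A finite simple graph is a pair_graph of the Graph Theory entry: finitely many vertices, and
  a symmetric, loop-free set of arcs, so that an edge is a pair of opposite arcs.\<close>

definition independent_set :: "'a pair_pre_digraph \<Rightarrow> 'a set \<Rightarrow> bool" where
  "independent_set G S \<longleftrightarrow> S \<subseteq> pverts G \<and> (\<forall>u\<in>S. \<forall>v\<in>S. (u, v) \<notin> parcs G)"

definition independence_number :: "'a pair_pre_digraph \<Rightarrow> nat" where
  "independence_number G = Max (card ` {S. independent_set G S})"

definition num_independent :: "'a pair_pre_digraph \<Rightarrow> nat \<Rightarrow> nat" where
  "num_independent G i = card {S. independent_set G S \<and> card S = i}"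

definition independence_poly :: "'a pair_pre_digraph \<Rightarrow> complex poly" where
  "independence_poly G = (\<Sum>i\<le>independence_number G. monom (of_nat (num_independent G i)) i)"

definition lex_product ::
  "'a pair_pre_digraph \<Rightarrow> 'b pair_pre_digraph \<Rightarrow> ('a \<times> 'b) pair_pre_digraph" where
  "lex_product G H =
     \<lparr> pverts = pverts G \<times> pverts H,
       parcs = {((a, x), (b, y)) | a x b y.
                  a \<in> pverts G \<and> b \<in> pverts G \<and> x \<in> pverts H \<and> y \<in> pverts H \<and>
                  ((a, b) \<in> parcs G \<or> a = b \<and> (x, y) \<in> parcs H)} \<rparr>"

definition relabel :: "('a \<Rightarrow> 'b) \<Rightarrow> 'a pair_pre_digraph \<Rightarrow> 'b pair_pre_digraph" where
  "relabel f G = \<lparr> pverts = f ` pverts G, parcs = map_prod f f ` parcs G \<rparr>"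

text \<open>The vertices of the m-fold product are the lists of length m over the vertices of G, so that
  all powers live in one type: the vertex (v, vs) of the product of G with the m-th power is
  renamed to v # vs. The 0-th power, a single vertex, is the neutral element of the product.\<close>

primrec lex_power :: "'a pair_pre_digraph \<Rightarrow> nat \<Rightarrow> 'a list pair_pre_digraph" where
  "lex_power G 0 = \<lparr> pverts = {[]}, parcs = {} \<rparr>"
| "lex_power G (Suc m) = relabel (\<lambda>(v, vs). v # vs) (lex_product G (lex_power G m))"

lemma lex_power_1:
  assumes "pair_wf_digraph G"
  shows "lex_power G 1 = relabel (\<lambda>v. [v]) G"
proof -
  interpret pair_wf_digraph G by fact
  show ?thesis
    by (force simp: relabel_def lex_product_def image_iff dest: in_arcsD1 in_arcsD2)
qed

definition roots :: "complex poly \<Rightarrow> complex set" where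
  "roots p = {z. poly p z = 0}"

text \<open>Meaningful for nonempty bounded sets only.\<close>

definition hausdorff_dist :: "'a::metric_space set \<Rightarrow> 'a set \<Rightarrow> real" where
  "hausdorff_dist S T = max (SUP x\<in>S. infdist x T) (SUP y\<in>T. infdist y S)"

definition hausdorff_limit :: "(nat \<Rightarrow> 'a::metric_space set) \<Rightarrow> 'a set \<Rightarrow> bool" where
  "hausdorff_limit X A \<longleftrightarrow>
     compact A \<and> A \<noteq> {} \<and> (\<lambda>m. hausdorff_dist (X m) A) \<longlonglongrightarrow> 0"

definition independence_attractor :: "'a pair_pre_digraph \<Rightarrow> complex set" where
  "independence_attractor G =
     (THE A. hausdorff_limit (\<lambda>m. roots (independence_poly (lex_power G m))) A)"

definition totally_disconnected :: "'a::topological_space set \<Rightarrow> bool" where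
  "totally_disconnected S \<longleftrightarrow> (\<forall>C\<in>components S. \<exists>x. C = {x})"

end

theory Submission
  imports Defs "HOL-Complex_Analysis.Complex_Analysis"
    "HOL-Computational_Algebra.Fundamental_Theorem_Algebra"
begin

text \<open>Substituting \<open>I\<^sub>H(z) - 1\<close> into \<open>I\<^sub>G\<close> gives the independence polynomial of the lexicographic product,
  so the roots for the \<open>m\<close>-th power are the preimages of \<open>-1\<close> under the \<open>m\<close>-th iterate of
  \<open>f = I\<^sub>G - 1\<close>. They converge to the boundary of the filled Julia set \<open>K\<close> of \<open>f\<close>, unless \<open>-1\<close> lies on
  an attracting cycle. As \<open>f\<close> has integer coefficients and no constant term, this happens only if
  \<open>I\<^sub>G = (1 + z)\<^sup>2 (1 + a\<^sub>3 z)\<close>; the limit is then larger and has \<open>-1\<close> as an isolated point.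
  Write \<open>p\<^sub>2 < p\<^sub>1 < 0\<close> for the nonzero fixed points. If a critical value lies outside of \<open>[p\<^sub>2, 0]\<close>, a branch
  of the hyperbola of nonreal points with real image escapes and separates \<open>0\<close> from \<open>p\<^sub>2\<close>; if \<open>f\<close> maps
  \<open>[p\<^sub>2, 0]\<close> into itself, preimages of large discs remain connected. Which alternative holds is decided
  by the sign of \<open>4 a\<^sub>2\<^sup>2 - (a\<^sub>1 + 3)\<^sup>2 a\<^sub>3\<close>, and the coefficients with \<open>a\<^sub>1 \<le> 8\<close> that would violate the
  claim are excluded by the Moon--Moser inequality for the complement graph. If \<open>p\<^sub>1\<close> attracts, \<open>K\<close> has
  interior, and its boundary separates the plane.\<close>

section \<open>Independence polynomials of lexicographic powers\<close>

text \<open>The thresholds for \<open>a2^2\<close> sort the multiplier of \<open>p1\<close>: it lies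
  strictly between 0 and 1 in (1a), is 0 in (1b), lies strictly between -1 and 0 in (1c), equals -1
  in (1d) and is below -1 in (1e). Connectedness is governed by another curve,
  \<open>4 * a2^2 = (a1 + 3)^2 * a3\<close>. It meets the curve of multiplier -1 at
  \<open>a1 = 7\<close> and, beyond \<open>a1 = 1\<close>, the curve
  \<open>a2^2 = 4 * a1 * a3\<close> at \<open>a1 = 9\<close>; this is the origin of these two
  bounds. The triples left out of (1e) satisfy the hypotheses of \<open>connected_frontier\<close>.
  The convergence rests on recurrence: if preimages of -1 accumulate inside \<open>K\<close>,
  equicontinuity there makes the orbit of -1 return arbitrarily close to -1, and for integers this
  means an exact return. The multipliers left are -1, 0 and 1. Bounded derivatives of the iterates
  cannot exclude -1, so a separate growth argument is required for parabolic points; 1 would merge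
  the two nonzero fixed points.\<close>

lemma finite_independent_sets:
  assumes "finite (pverts G)"
  shows "finite {S. independent_set G S}"
  by (rule finite_subset[of _ "Pow (pverts G)"]) (use assms in \<open>auto simp: independent_set_def\<close>)

lemma independent_set_empty [simp]: "independent_set G {}"
  by (simp add: independent_set_def)

lemma card_le_independence_number:
  assumes "finite (pverts G)" "independent_set G S"
  shows "card S \<le> independence_number G"
  unfolding independence_number_def
  by (rule Max_ge) (use assms finite_independent_sets in auto)

lemma coeff_independence_poly:
  assumes "finite (pverts G)"
  shows "coeff (independence_poly G) i = of_nat (num_independent G i)"
proof (cases "i \<le> independence_number G")
  case False
  then have "{S. independent_set G S \<and> card S = i} = {}"
    using card_le_independence_number[OF assms] by auto
  then have "num_independent G i = 0"
    by (simp only: num_independent_def card.empty)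
  then show ?thesis
    using False by (simp add: independence_poly_def coeff_sum)
qed (simp add: independence_poly_def coeff_sum)

lemma poly_independence_poly:
  assumes "finite (pverts G)"
  shows "poly (independence_poly G) z = (\<Sum>S | independent_set G S. z ^ card S)"
proof -
  have "(\<Sum>S | independent_set G S. z ^ card S)
      = (\<Sum>i\<le>independence_number G. \<Sum>S\<in>{S. independent_set G S \<and> card S = i}. z ^ card S)"
    using card_le_independence_number[OF assms] finite_independent_sets[OF assms]
    by (subst sum.group[symmetric, where g = card and T = "{..independence_number G}"]) auto
  also have "\<dots> = (\<Sum>i\<le>independence_number G. of_nat (num_independent G i) * z ^ i)"
    by (intro sum.cong refl) (simp add: num_independent_def)
  finally show ?thesis
    by (simp add: independence_poly_def poly_sum poly_monom)
qed

lemma num_independent_independence_number_pos: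
  assumes "finite (pverts G)"
  shows "num_independent G (independence_number G) > 0"
proof -
  have "independence_number G \<in> card ` {S. independent_set G S}"
    unfolding independence_number_def
    by (rule Max_in) (use finite_independent_sets[OF assms] in \<open>auto intro!: exI[of _ "{}"]\<close>)
  then have "{S. independent_set G S \<and> card S = independence_number G} \<noteq> {}"
    by auto
  moreover have "finite {S. independent_set G S \<and> card S = independence_number G}"
    using finite_independent_sets[OF assms] by (rule rev_finite_subset) auto
  ultimately show ?thesis
    by (simp add: num_independent_def card_gt_0_iff)
qed

lemma independent_set_relabel:
  assumes "inj f"
  shows "independent_set (relabel f G) S \<longleftrightarrow> (\<exists>T. independent_set G T \<and> S = f ` T)"
proof
  assume S: "independent_set (relabel f G) S"
  then obtain T where T: "T \<subseteq> pverts G" "S = f ` T"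
    by (auto simp: independent_set_def relabel_def subset_image_iff)
  have "(u, v) \<notin> parcs G" if "u \<in> T" "v \<in> T" for u v
  proof
    assume "(u, v) \<in> parcs G"
    then have "map_prod f f (u, v) \<in> map_prod f f ` parcs G" by (rule imageI)
    with S T that show False
      by (auto simp: independent_set_def relabel_def)
  qed
  with T show "\<exists>T. independent_set G T \<and> S = f ` T"
    by (auto simp: independent_set_def)
next
  assume "\<exists>T. independent_set G T \<and> S = f ` T"
  then show "independent_set (relabel f G) S"
    using assms by (auto simp: independent_set_def relabel_def inj_eq)
qed

lemma poly_independence_poly_relabel:
  assumes "inj f" "finite (pverts G)"
  shows "poly (independence_poly (relabel f G)) z = poly (independence_poly G) z"
proof -
  have fin: "finite (pverts (relabel f G))"
    using assms(2) by (simp add: relabel_def)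
  have "{S. independent_set (relabel f G) S} = (`) f ` {T. independent_set G T}"
    using independent_set_relabel[OF assms(1)] by auto
  then have "(\<Sum>S | independent_set (relabel f G) S. z ^ card S)
      = (\<Sum>T | independent_set G T. z ^ card (f ` T))"
    using assms(1) by (simp add: sum.reindex inj_on_def inj_image_eq_iff)
  then show ?thesis
    using assms by (simp add: poly_independence_poly fin card_image inj_on_subset)
qed

text \<open>An independent set is recovered from its projection \<open>T\<close> to \<open>G\<close>
  and its fibres \<open>U\<close>. Nonempty fibres and extensionality of \<open>U\<close> make the
  pair unique, so that sets can be counted by pairs.\<close>

lemma independent_set_lex_product:
  "independent_set (lex_product G H) S \<longleftrightarrow>
     (\<exists>T U. independent_set G T \<and> U \<in> PiE T (\<lambda>_. {A. independent_set H A \<and> A \<noteq> {}}) \<and> S = Sigma T U)"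
proof
  assume S: "independent_set (lex_product G H) S"
  define T where "T = fst ` S"
  define U where "U = (\<lambda>a\<in>T. {x. (a, x) \<in> S})"
  have sub: "S \<subseteq> pverts G \<times> pverts H"
    and ind: "\<And>a x b y. (a, x) \<in> S \<Longrightarrow> (b, y) \<in> S \<Longrightarrow> (a, b) \<notin> parcs G \<and> (a = b \<longrightarrow> (x, y) \<notin> parcs H)"
    using S unfolding independent_set_def lex_product_def by fastforce+
  have "independent_set G T"
    using sub ind by (fastforce simp: independent_set_def T_def)
  moreover have "U \<in> PiE T (\<lambda>_. {A. independent_set H A \<and> A \<noteq> {}})"
    using sub ind by (fastforce simp: independent_set_def T_def U_def)
  moreover have "S = Sigma T U"
  proof -
    have "a \<in> T" if "(a, x) \<in> S" for a x
      using that by (force simp: T_def)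
    then show ?thesis
      by (auto simp: U_def)
  qed
  ultimately show "\<exists>T U. independent_set G T \<and> U \<in> PiE T (\<lambda>_. {A. independent_set H A \<and> A \<noteq> {}})
      \<and> S = Sigma T U" by blast
next
  assume "\<exists>T U. independent_set G T \<and> U \<in> PiE T (\<lambda>_. {A. independent_set H A \<and> A \<noteq> {}}) \<and> S = Sigma T U"
  then show "independent_set (lex_product G H) S"
    unfolding independent_set_def lex_product_def by (auto simp: PiE_iff subset_iff)
qed

text \<open>Each vertex of the projection contributes one factor, the sum of
  \<open>z ^ card A\<close> over the possible fibres \<open>A\<close>. The fibres are the nonempty
  independent sets, which accounts for the subtraction of 1.\<close>

lemma poly_independence_poly_lex_product:
  assumes "finite (pverts G)" "finite (pverts H)"
  shows "poly (independence_poly (lex_product G H)) z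
       = poly (independence_poly G) (poly (independence_poly H) z - 1)"
proof -
  define I where "I = {A. independent_set H A \<and> A \<noteq> {}}"
  define P where "P = (SIGMA T:{T. independent_set G T}. PiE T (\<lambda>_. I))"
  have fin: "finite (pverts (lex_product G H))"
    using assms by (simp add: lex_product_def)
  have finG: "finite T" if "independent_set G T" for T
    using that assms(1) by (auto simp: independent_set_def intro: finite_subset)
  have finH: "finite A" if "A \<in> I" for A
    using that assms(2) by (auto simp: I_def independent_set_def intro: finite_subset)
  have finI: "finite I"
    using finite_independent_sets[OF assms(2)] by (rule rev_finite_subset) (auto simp: I_def)
  have inj: "inj_on (\<lambda>(T, U). Sigma T U) P"
  proof (rule inj_onI, clarify)
    fix T U T' U'
    assume TU: "(T, U) \<in> P" "(T', U') \<in> P" and eq: "Sigma T U = Sigma T' U'"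
    have ne: "\<And>a. a \<in> T \<Longrightarrow> U a \<noteq> {}" "\<And>a. a \<in> T' \<Longrightarrow> U' a \<noteq> {}"
      using TU by (auto simp: P_def I_def PiE_iff)
    have "T = fst ` Sigma T U" "T' = fst ` Sigma T' U'"
      using ne by (force simp: image_iff)+
    with eq have T: "T = T'" by simp
    have "U a = U' a" if "a \<in> T" for a
      using eq that T by (auto simp: set_eq_iff)
    then have "U = U'"
      using TU T by (intro PiE_ext[of U T "\<lambda>_. I" U']) (auto simp: P_def)
    with T show "T = T' \<and> U = U'" by simp
  qed
  have "{S. independent_set (lex_product G H) S} = (\<lambda>(T, U). Sigma T U) ` P"
    by (auto simp: independent_set_lex_product P_def I_def image_iff)
  then have "poly (independence_poly (lex_product G H)) z = (\<Sum>(T, U)\<in>P. z ^ card (Sigma T U))"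
    using inj by (simp add: poly_independence_poly[OF fin] sum.reindex case_prod_unfold)
  also have "\<dots> = (\<Sum>T | independent_set G T. \<Sum>U\<in>PiE T (\<lambda>_. I). z ^ card (Sigma T U))"
    unfolding P_def
    by (rule sum.Sigma[symmetric])
      (use finite_independent_sets[OF assms(1)] finG finI in \<open>auto intro!: finite_PiE\<close>)
  also have "\<dots> = (\<Sum>T | independent_set G T. \<Sum>U\<in>PiE T (\<lambda>_. I). \<Prod>a\<in>T. z ^ card (U a))"
  proof (intro sum.cong refl)
    fix T U assume "T \<in> {T. independent_set G T}" "U \<in> PiE T (\<lambda>_. I)"
    then show "z ^ card (Sigma T U) = (\<Prod>a\<in>T. z ^ card (U a))"
      using finG finH by (subst card_SigmaI) (auto simp: power_sum PiE_iff)
  qed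
  also have "\<dots> = (\<Sum>T | independent_set G T. \<Prod>a\<in>T. \<Sum>A\<in>I. z ^ card A)"
    using finG finI by (intro sum.cong refl) (subst prod_sum_PiE, auto)
  also have "(\<Sum>A\<in>I. z ^ card A) = poly (independence_poly H) z - 1"
  proof -
    have "{S. independent_set H S} = insert {} I" "{} \<notin> I"
      by (auto simp: I_def)
    then show ?thesis
      using finI by (simp add: poly_independence_poly[OF assms(2)])
  qed
  finally show ?thesis
    by (simp add: poly_independence_poly[OF assms(1)])
qed

lemma finite_pverts_lex_power:
  assumes "finite (pverts G)"
  shows "finite (pverts (lex_power G m))"
  using assms by (induction m) (auto simp: relabel_def lex_product_def)

lemma poly_independence_poly_lex_power:
  fixes G :: "'a pair_pre_digraph"
  assumes "finite (pverts G)"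
  shows "poly (independence_poly (lex_power G m)) z
       = ((\<lambda>w. poly (independence_poly G) w - 1) ^^ m) z + 1"
proof (induction m)
  case 0
  have "{S. independent_set (lex_power G 0) S} = {{}, {[]}}"
    by (auto simp: independent_set_def)
  then show ?case
    using finite_pverts_lex_power[OF assms, of 0] by (subst poly_independence_poly) auto
next
  case (Suc m)
  have "inj (\<lambda>(v :: 'a, vs). v # vs)"
    by (auto simp: inj_def)
  moreover have "finite (pverts (lex_product G (lex_power G m)))"
    using assms finite_pverts_lex_power[OF assms, of m] by (simp add: lex_product_def)
  ultimately show ?case
    using assms finite_pverts_lex_power[OF assms, of m]
    by (simp add: poly_independence_poly_relabel poly_independence_poly_lex_product Suc)
qed

section \<open>The Moon--Moser inequality\<close>

text \<open>An edge \<open>uv\<close> lies in at least \<open>deg u + deg v - n\<close> triangles, and the resulting sum of squared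
  degrees is estimated by the Cauchy--Schwarz inequality.\<close>

lemma moon_moser:
  fixes E :: "'a \<Rightarrow> 'a \<Rightarrow> bool"
  assumes fin: "finite V"
    and E: "\<And>u v. E u v \<Longrightarrow> u \<in> V \<and> v \<in> V \<and> u \<noteq> v" "\<And>u v. E u v \<Longrightarrow> E v u"
    and e: "e = card {S. \<exists>u v. E u v \<and> S = {u, v}}"
    and t: "t = card {S. \<exists>u v w. E u v \<and> E u w \<and> E v w \<and> S = {u, v, w}}"
  shows "4 * e\<^sup>2 \<le> 3 * card V * t + (card V)\<^sup>2 * e"
proof -
  define n where "n = card V"
  define N where "N u = {v. E u v}" for u
  define P where "P = (SIGMA u:V. N u)"
  define T where "T = (SIGMA p:P. N (fst p) \<inter> N (snd p))"
  have N: "N u \<subseteq> V" "finite (N u)" for u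
    using E(1) finite_subset[OF _ fin, of "N u"] by (auto simp: N_def)
  have finP: "finite P" and finT: "finite T"
    using fin N by (auto simp: P_def T_def)
  have cP: "card P = (\<Sum>u\<in>V. card (N u))"
    unfolding P_def using fin N by (intro card_SigmaI) auto
  have e2: "card P = 2 * e"
  proof -
    define g :: "'a \<times> 'a \<Rightarrow> 'a set" where "g p = {fst p, snd p}" for p
    have "card P = (\<Sum>S\<in>g ` P. card {p \<in> P. g p = S})"
      using sum.image_gen[OF finP, of "\<lambda>_. 1::nat" g] by simp
    also have "\<dots> = (\<Sum>S\<in>g ` P. 2)"
    proof (rule sum.cong[OF refl])
      fix S assume "S \<in> g ` P"
      then obtain u v where uv: "E u v" "S = {u, v}"
        by (auto simp: P_def N_def g_def)
      have "{p \<in> P. g p = S} = {(u, v), (v, u)}"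
      proof (rule set_eqI)
        fix p show "p \<in> {p \<in> P. g p = S} \<longleftrightarrow> p \<in> {(u, v), (v, u)}"
          using E(1)[OF uv(1)] E(2)[OF uv(1)] uv(1)
          by (cases p) (auto simp: P_def N_def g_def uv(2) doubleton_eq_iff)
      qed
      then show "card {p \<in> P. g p = S} = 2"
        using E(1)[OF uv(1)] by simp
    qed
    also have "g ` P = {S. \<exists>u v. E u v \<and> S = {u, v}}"
    proof (intro set_eqI iffI)
      fix S assume "S \<in> {S. \<exists>u v. E u v \<and> S = {u, v}}"
      then obtain u v where uv: "E u v" "S = {u, v}"
        by auto
      then have "(u, v) \<in> P" "g (u, v) = S"
        using E(1)[OF uv(1)] by (auto simp: P_def N_def g_def)
      then show "S \<in> g ` P" by blast
    next
      fix S assume "S \<in> g ` P"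
      then obtain u v where "E u v" "S = {u, v}"
        by (auto simp: P_def N_def g_def)
      then show "S \<in> {S. \<exists>u v. E u v \<and> S = {u, v}}"
        by blast
    qed
    finally show ?thesis
      by (simp add: e)
  qed
  \<comment> \<open>The inequality suffices: a triangle is listed by at most the six orderings of
    its vertices.\<close>
  have t6: "card T \<le> 6 * t"
  proof -
    define g :: "('a \<times> 'a) \<times> 'a \<Rightarrow> 'a set" where "g p = {fst (fst p), snd (fst p), snd p}" for p
    have "card T = (\<Sum>S\<in>g ` T. card {p \<in> T. g p = S})"
      using sum.image_gen[OF finT, of "\<lambda>_. 1::nat" g] by simp
    also have "\<dots> \<le> (\<Sum>S\<in>g ` T. 6)"
    proof (rule sum_mono)
      fix S assume "S \<in> g ` T"
      then obtain u v w where uvw: "E u v" "E u w" "E v w" "S = {u, v, w}"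
        by (auto simp: P_def T_def N_def g_def)
      have "{p \<in> T. g p = S} \<subseteq> set [((u, v), w), ((u, w), v), ((v, u), w), ((v, w), u), ((w, u), v), ((w, v), u)]"
      proof
        fix p assume "p \<in> {p \<in> T. g p = S}"
        moreover obtain a b c where p: "p = ((a, b), c)"
          by (metis prod.collapse)
        ultimately have "E a b" "E a c" "E b c" and S: "{a, b, c} = S"
          by (auto simp: P_def T_def N_def g_def)
        then have "a \<noteq> b" "a \<noteq> c" "b \<noteq> c"
          using E(1)[of a b] E(1)[of a c] E(1)[of b c] by auto
        moreover have "a \<in> {u, v, w}" "b \<in> {u, v, w}" "c \<in> {u, v, w}"
          using S uvw(4) by auto
        ultimately show "p \<in> set [((u, v), w), ((u, w), v), ((v, u), w), ((v, w), u), ((w, u), v), ((w, v), u)]"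
          unfolding p by auto
      qed
      then have "card {p \<in> T. g p = S} \<le> card (set [((u, v), w), ((u, w), v), ((v, u), w), ((v, w), u), ((w, u), v), ((w, v), u)])"
        by (intro card_mono) auto
      also have "\<dots> \<le> 6"
        by (rule order_trans[OF card_length]) simp
      finally show "card {p \<in> T. g p = S} \<le> 6" .
    qed
    also have "g ` T = {S. \<exists>u v w. E u v \<and> E u w \<and> E v w \<and> S = {u, v, w}}"
    proof (intro set_eqI iffI)
      fix S assume "S \<in> {S. \<exists>u v w. E u v \<and> E u w \<and> E v w \<and> S = {u, v, w}}"
      then obtain u v w where uvw: "E u v" "E u w" "E v w" "S = {u, v, w}"
        by auto
      then have "((u, v), w) \<in> T" "g ((u, v), w) = S"
        using E(1)[OF uvw(1)] by (auto simp: P_def T_def N_def g_def)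
      then show "S \<in> g ` T" by blast
    next
      fix S assume "S \<in> g ` T"
      then obtain u v w where "E u v" "E u w" "E v w" "S = {u, v, w}"
        by (auto simp: P_def T_def N_def g_def)
      then show "S \<in> {S. \<exists>u v w. E u v \<and> E u w \<and> E v w \<and> S = {u, v, w}}"
        by blast
    qed
    finally show ?thesis
      by (simp add: t)
  qed
  have sq: "(\<Sum>p\<in>P. real (card (N (fst p)))) = (\<Sum>u\<in>V. (real (card (N u)))\<^sup>2)"
    unfolding P_def using fin N
    by (subst sum.Sigma[symmetric, where g = "\<lambda>u v. real (card (N u))", simplified case_prod_unfold])
       (auto simp: power2_eq_square)
  have sq': "(\<Sum>p\<in>P. real (card (N (snd p)))) = (\<Sum>p\<in>P. real (card (N (fst p))))"
    by (rule sum.reindex_bij_witness[of _ prod.swap prod.swap]) (auto simp: P_def N_def dest: E(1) intro: E(2))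
  have "2 * (\<Sum>u\<in>V. (real (card (N u)))\<^sup>2) - real n * card P
      = (\<Sum>p\<in>P. real (card (N (fst p))) + real (card (N (snd p))) - real n)"
    by (simp add: sum.distrib sum_subtractf sq sq')
  also have "\<dots> \<le> (\<Sum>p\<in>P. real (card (N (fst p) \<inter> N (snd p))))"
  proof (rule sum_mono)
    fix p assume "p \<in> P"
    have "card (N (fst p)) + card (N (snd p)) = card (N (fst p) \<union> N (snd p)) + card (N (fst p) \<inter> N (snd p))"
      by (rule card_Un_Int) (use N in auto)
    moreover have "card (N (fst p) \<union> N (snd p)) \<le> n"
      unfolding n_def by (rule card_mono[OF fin]) (use N in auto)
    ultimately show "real (card (N (fst p))) + real (card (N (snd p))) - real n \<le> card (N (fst p) \<inter> N (snd p))"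
      by linarith
  qed
  also have "\<dots> = real (card T)"
    unfolding T_def using finP N by (subst card_SigmaI) auto
  also have "\<dots> \<le> 6 * real t"
    using t6 by linarith
  finally have *: "2 * (\<Sum>u\<in>V. (real (card (N u)))\<^sup>2) - real n * (2 * real e) \<le> 6 * real t"
    by (simp add: e2)
  have "(2 * real e)\<^sup>2 \<le> (\<Sum>u\<in>V. (real (card (N u)))\<^sup>2) * real n"
    using sum_squared_le_sum_of_squares[of "\<lambda>u. real (card (N u))" V] e2 cP
    by (metis n_def of_nat_mult of_nat_numeral of_nat_sum)
  \<comment> \<open>After multiplication by \<open>n\<close> the sum of squared degrees can be
    bounded below by the square of the degree sum \<open>2 * e\<close>.\<close>
  moreover have "real n * (2 * (\<Sum>u\<in>V. (real (card (N u)))\<^sup>2) - real n * (2 * real e)) \<le> real n * (6 * real t)"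
    by (rule mult_left_mono[OF *]) simp
  ultimately have "4 * (real e)\<^sup>2 \<le> 3 * real n * real t + (real n)\<^sup>2 * real e"
    by (simp add: algebra_simps power2_eq_square)
  then have "real (4 * e\<^sup>2) \<le> real (3 * n * t + n\<^sup>2 * e)"
    by simp
  then show ?thesis
    by (simp only: of_nat_le_iff n_def)
qed

lemma num_independent_1:
  assumes "pair_loopfree_digraph G"
  shows "num_independent G 1 = card (pverts G)"
proof -
  interpret pair_loopfree_digraph G by fact
  have "{S. independent_set G S \<and> card S = 1} = (\<lambda>v. {v}) ` pverts G"
    using pair_no_loops by (force simp: independent_set_def card_1_singleton_iff)
  then show ?thesis
    by (simp add: num_independent_def card_image)
qed

text \<open>Independent pairs and triples of \<open>G\<close> are the edges and triangles of the
  complement graph \<open>E\<close>.\<close>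

lemma num_independent_moon_moser:
  assumes "pair_graph G"
  shows "4 * (num_independent G 2)\<^sup>2
    \<le> 3 * num_independent G 1 * num_independent G 3 + (num_independent G 1)\<^sup>2 * num_independent G 2"
proof -
  interpret pair_graph G by fact
  define E where "E u v \<longleftrightarrow> u \<in> pverts G \<and> v \<in> pverts G \<and> u \<noteq> v \<and> (u, v) \<notin> parcs G" for u v
  have noloop: "(u, u) \<notin> parcs G" for u
    using pair_no_loops by force
  have symG: "(v, u) \<in> parcs G" if "(u, v) \<in> parcs G" for u v
    using that pair_sym_arcs by (auto simp: symmetric_def sym_def)
  have 1: "num_independent G 1 = card (pverts G)"
    by (rule num_independent_1) unfold_locales
  have E: "(u, v) \<notin> parcs G \<and> (v, u) \<notin> parcs G" if "E u v" for u v
    using that symG by (auto simp: E_def)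
  have 2: "{S. independent_set G S \<and> card S = 2} = {S. \<exists>u v. E u v \<and> S = {u, v}}" (is "?L = ?R")
  proof (intro set_eqI iffI)
    fix S assume S: "S \<in> ?L"
    then obtain u v where "S = {u, v}" "u \<noteq> v"
      by (auto simp: card_2_iff)
    with S show "S \<in> ?R"
      by (auto simp: independent_set_def E_def)
  next
    fix S assume "S \<in> ?R"
    then obtain u v where "E u v" "S = {u, v}"
      by auto
    then show "S \<in> ?L"
      using noloop E[of u v] by (auto simp: independent_set_def E_def)
  qed
  have 3: "{S. independent_set G S \<and> card S = 3}
      = {S. \<exists>u v w. E u v \<and> E u w \<and> E v w \<and> S = {u, v, w}}" (is "?L = ?R")
  proof (intro set_eqI iffI)
    fix S assume S: "S \<in> ?L"
    then obtain u v w where uvw: "S = {u, v, w}" "u \<noteq> v" "u \<noteq> w" "v \<noteq> w"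
      by (auto simp: card_3_iff)
    with S have "E u v" "E u w" "E v w"
      by (simp_all add: independent_set_def E_def)
    with uvw show "S \<in> ?R" by blast
  next
    fix S assume "S \<in> ?R"
    then obtain u v w where uvw: "E u v" "E u w" "E v w" "S = {u, v, w}"
      by auto
    then have "card S = 3"
      by (simp add: E_def)
    moreover have "independent_set G S"
      unfolding independent_set_def uvw(4)
      using noloop E[OF uvw(1)] E[OF uvw(2)] E[OF uvw(3)] uvw(1-3) by (simp add: E_def)
    ultimately show "S \<in> ?L" by simp
  qed
  show ?thesis
    unfolding 1
  proof (rule moon_moser[of "pverts G" E])
    show "E v u" if "E u v" for u v
      using that symG[of v u] by (auto simp: E_def)
  qed (simp_all only: pair_finite_verts 2 3 num_independent_def, auto simp: E_def)
qed

section \<open>Hausdorff limits\<close>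

text \<open>Compactness bounds the distances, so the real suprema in \<open>hausdorff_dist\<close>
  are genuine upper bounds.\<close>

lemma infdist_le_hausdorff_dist:
  assumes "compact S" "compact T"
  shows "x \<in> S \<Longrightarrow> infdist x T \<le> hausdorff_dist S T"
    and "y \<in> T \<Longrightarrow> infdist y S \<le> hausdorff_dist S T"
proof -
  have bdd: "bdd_above ((\<lambda>x. infdist x B) ` A)" if "compact A" for A B :: "'a set"
    using that by (intro bounded_imp_bdd_above compact_imp_bounded compact_continuous_image continuous_intros)
  show "x \<in> S \<Longrightarrow> infdist x T \<le> hausdorff_dist S T"
    unfolding hausdorff_dist_def by (rule max.coboundedI1, rule cSUP_upper) (use bdd assms in auto)
  show "y \<in> T \<Longrightarrow> infdist y S \<le> hausdorff_dist S T"
    unfolding hausdorff_dist_def by (rule max.coboundedI2, rule cSUP_upper) (use bdd assms in auto)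
qed

lemma hausdorff_limit_subset:
  fixes X :: "nat \<Rightarrow> 'a::heine_borel set"
  assumes X: "\<And>m. compact (X m)" "\<And>m. X m \<noteq> {}"
    and A: "hausdorff_limit X A" and B: "hausdorff_limit X B"
  shows "A \<subseteq> B"
proof
  fix a assume a: "a \<in> A"
  have cA: "compact A" and cB: "compact B" "B \<noteq> {}"
    using A B by (auto simp: hausdorff_limit_def)
  have "infdist a B \<le> hausdorff_dist (X m) A + hausdorff_dist (X m) B" for m
  proof -
    obtain x where x: "x \<in> X m" "infdist a (X m) = dist a x"
      using infdist_attains_inf[of "X m" a] X compact_imp_closed by blast
    have "infdist a B \<le> infdist x B + dist a x"
      by (rule infdist_triangle)
    also have "\<dots> \<le> hausdorff_dist (X m) B + hausdorff_dist (X m) A"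
      using infdist_le_hausdorff_dist(1)[OF X(1) cB(1) x(1)]
        infdist_le_hausdorff_dist(2)[OF X(1) cA a, of m] x(2) by simp
    finally show ?thesis by simp
  qed
  moreover have "(\<lambda>m. hausdorff_dist (X m) A + hausdorff_dist (X m) B) \<longlonglongrightarrow> 0 + 0"
    using A B by (intro tendsto_add) (auto simp: hausdorff_limit_def)
  ultimately have "infdist a B \<le> 0"
    by (intro LIMSEQ_le_const) auto
  then show "a \<in> B"
    using cB in_closed_iff_infdist_zero[of B a] infdist_nonneg[of a B] compact_imp_closed by force
qed

text \<open>This is what gives the definite description in \<open>independence_attractor\<close> its
  meaning.\<close>

lemma hausdorff_limit_unique:
  fixes X :: "nat \<Rightarrow> 'a::heine_borel set"
  assumes "\<And>m. compact (X m)" "\<And>m. X m \<noteq> {}" "hausdorff_limit X A" "hausdorff_limit X B"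
  shows "A = B"
  using hausdorff_limit_subset[OF assms(1,2,3,4)] hausdorff_limit_subset[OF assms(1,2,4,3)]
  by (rule subset_antisym)

text \<open>Inside a compact set, Hausdorff convergence reduces to the two Kuratowski conditions
  \<open>lower\<close> and \<open>upper\<close>. Points of \<open>X m\<close> that stay far from
  \<open>A\<close> for infinitely many \<open>m\<close> would have a convergent subsequence, against
  \<open>upper\<close>; a finite \<open>e / 2\<close>-net of \<open>A\<close> makes
  \<open>lower\<close> uniform.\<close>

lemma hausdorff_limitI:
  fixes X :: "nat \<Rightarrow> 'a::metric_space set"
  assumes X: "\<And>m. X m \<noteq> {}" "\<And>m. X m \<subseteq> C" and C: "compact C"
    and A: "closed A" "A \<noteq> {}" "A \<subseteq> C"
    and lower: "\<And>a e. a \<in> A \<Longrightarrow> e > 0 \<Longrightarrow> \<forall>\<^sub>F m in sequentially. \<exists>x\<in>X m. dist x a < e"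
    and upper: "\<And>s x z. strict_mono (s :: nat \<Rightarrow> nat) \<Longrightarrow> (\<And>k. x k \<in> X (s k)) \<Longrightarrow> x \<longlonglongrightarrow> z \<Longrightarrow> z \<in> A"
  shows "hausdorff_limit X A"
proof -
  have cA: "compact A"
    using A C by (metis compact_Int_closed inf.absorb_iff2)
  have ev: "\<forall>\<^sub>F m in sequentially. hausdorff_dist (X m) A \<le> e" if e: "e > 0" for e
  proof -
    have 1: "\<forall>\<^sub>F m in sequentially. \<forall>x\<in>X m. infdist x A \<le> e"
    proof (rule ccontr)
      assume "\<not> (\<forall>\<^sub>F m in sequentially. \<forall>x\<in>X m. infdist x A \<le> e)"
      then have "\<exists>\<^sub>\<infinity>m. \<exists>x\<in>X m. infdist x A > e"
        by (simp add: not_eventually cofinite_eq_sequentially not_le)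
      then have "infinite {m. \<exists>x\<in>X m. infdist x A > e}"
        by (simp add: frequently_cofinite)
      from infinite_enumerate[OF this] obtain s :: "nat \<Rightarrow> nat"
        where s: "strict_mono s" "\<And>k. \<exists>x\<in>X (s k). infdist x A > e"
        by auto
      then obtain x where x: "\<And>k. x k \<in> X (s k)" "\<And>k. infdist (x k) A > e"
        by metis
      have "range x \<subseteq> C"
        using x(1) X(2) by blast
      then obtain l r where r: "strict_mono r" "(x \<circ> r) \<longlonglongrightarrow> l"
        using C unfolding compact_def by (metis range_subsetD)
      have "l \<in> A"
        using upper[of "s \<circ> r" "x \<circ> r" l] s(1) r x(1) by (simp add: strict_mono_o)
      moreover have "(\<lambda>k. infdist ((x \<circ> r) k) A) \<longlonglongrightarrow> infdist l A"
        using r(2) by (rule tendsto_infdist)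
      then have "e \<le> infdist l A"
        using x(2) by (intro LIMSEQ_le_const) (auto intro: less_imp_le)
      ultimately show False
        using e by simp
    qed
    obtain D where D: "finite D" "D \<subseteq> A" "A \<subseteq> (\<Union>a\<in>D. ball a (e / 2))"
      using seq_compact_imp_totally_bounded[of A] cA compact_imp_seq_compact e half_gt_zero by metis
    have "\<forall>\<^sub>F m in sequentially. \<forall>a\<in>D. \<exists>x\<in>X m. dist x a < e / 2"
      using D e by (intro eventually_ball_finite ballI lower) auto
    then have 2: "\<forall>\<^sub>F m in sequentially. \<forall>a\<in>A. infdist a (X m) \<le> e"
    proof eventually_elim
      case (elim m)
      show ?case
      proof
        fix a assume "a \<in> A"
        then obtain d where d: "d \<in> D" "dist d a < e / 2"
          using D(3) by auto
        with elim obtain x where x: "x \<in> X m" "dist x d < e / 2"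
          by blast
        have "infdist a (X m) \<le> dist a x"
          using x(1) by (rule infdist_le)
        also have "\<dots> \<le> e"
          using dist_triangle[of a x d] d x by (simp add: dist_commute)
        finally show "infdist a (X m) \<le> e" .
      qed
    qed
    from 1 2 show ?thesis
      by eventually_elim (use X A in \<open>auto simp: hausdorff_dist_def intro!: cSUP_least\<close>)
  qed
  have nonneg: "0 \<le> hausdorff_dist (X m) A" for m
  proof -
    obtain y where "y \<in> A" using A by auto
    have "bdd_above ((\<lambda>y. infdist y (X m)) ` A)"
      by (intro bounded_imp_bdd_above compact_imp_bounded compact_continuous_image continuous_intros cA)
    with \<open>y \<in> A\<close> have "infdist y (X m) \<le> (SUP y\<in>A. infdist y (X m))"
      by (intro cSUP_upper)
    then show ?thesis
      using infdist_nonneg[of y "X m"] unfolding hausdorff_dist_def by linarith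
  qed
  have "(\<lambda>m. hausdorff_dist (X m) A) \<longlonglongrightarrow> 0"
  proof (intro tendstoI)
    fix e :: real assume e: "e > 0"
    then have "\<forall>\<^sub>F m in sequentially. hausdorff_dist (X m) A \<le> e / 2"
      using ev[of "e / 2"] by simp
    then show "\<forall>\<^sub>F m in sequentially. dist (hausdorff_dist (X m) A) 0 < e"
      by eventually_elim (use nonneg e in \<open>simp add: dist_real_def\<close>)
  qed
  then show ?thesis
    using cA A by (simp add: hausdorff_limit_def)
qed

section \<open>Iteration of entire maps that escape near infinity\<close>

locale escaping_map =
  fixes f :: "complex \<Rightarrow> complex" and R :: real
  assumes holo: "f holomorphic_on UNIV"
    and R_pos: "R > 0"
    and escape: "\<And>z. norm z > R \<Longrightarrow> norm (f z) \<ge> 2 * norm z"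
begin

text \<open>The filled Julia set, written with the fixed bound \<open>R\<close> instead of
  boundedness: an orbit that leaves the disc once grows geometrically, so \<open>K_memI\<close>
  recovers membership from any bound, while closedness is immediate.\<close>

definition K :: "complex set" where
  "K = {z. \<forall>n. norm ((f ^^ n) z) \<le> R}"

lemma holomorphic_iterate: "(f ^^ n) holomorphic_on A"
proof (induction n)
  case (Suc n)
  have "f \<circ> (f ^^ n) holomorphic_on A"
    by (rule holomorphic_on_compose[OF Suc holomorphic_on_subset[OF holo]]) simp
  then show ?case by (simp add: o_def)
qed (simp add: id_def)

lemma continuous_iterate: "continuous_on A (f ^^ n)"
  using holomorphic_iterate by (rule holomorphic_on_imp_continuous_on)

lemma iterate_norm_ge:
  assumes "norm z > R"
  shows "norm ((f ^^ n) z) \<ge> 2 ^ n * norm z"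
proof (induction n)
  case (Suc n)
  have "1 * norm z \<le> 2 ^ n * norm z"
    by (intro mult_right_mono) auto
  with Suc assms have "norm ((f ^^ n) z) > R" by simp
  from escape[OF this] Suc show ?case by simp
qed simp

lemma iterate_escapes:
  assumes "norm z > R"
  shows "norm ((f ^^ n) z) > R"
proof -
  have "1 * norm z \<le> 2 ^ n * norm z"
    by (intro mult_right_mono) auto
  with iterate_norm_ge[OF assms, of n] assms show ?thesis by simp
qed

lemma iterate_escapes_mono:
  assumes "norm ((f ^^ m) z) > R" "m \<le> n"
  shows "norm ((f ^^ n) z) > R"
  using iterate_escapes[OF assms(1), of "n - m"] assms(2)
  by (simp flip: funpow_add[THEN fun_cong, unfolded o_def])

lemma K_memI:
  assumes "\<And>n. norm ((f ^^ n) z) \<le> B"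
  shows "z \<in> K"
proof (rule ccontr)
  assume "z \<notin> K"
  then obtain m where m: "norm ((f ^^ m) z) > R"
    by (auto simp: K_def not_le)
  obtain n where "B / R < 2 ^ n"
    using real_arch_pow[of 2 "B / R"] by auto
  then have "B < 2 ^ n * R"
    using R_pos by (simp add: field_simps)
  also have "\<dots> \<le> 2 ^ n * norm ((f ^^ m) z)"
    using m by simp
  also have "\<dots> \<le> norm ((f ^^ n) ((f ^^ m) z))"
    using iterate_norm_ge[OF m] .
  also have "\<dots> = norm ((f ^^ (n + m)) z)"
    by (simp add: funpow_add)
  finally show False
    using assms[of "n + m"] by simp
qed

lemma not_K_unbounded:
  assumes "z \<notin> K"
  obtains N where "\<And>n. n \<ge> N \<Longrightarrow> norm ((f ^^ n) z) > B"
proof -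
  obtain m where m: "norm ((f ^^ m) z) > R"
    using assms by (auto simp: K_def not_le)
  obtain N where N: "B / R < real N"
    using reals_Archimedean2 by blast
  show thesis
  proof
    fix n assume n: "n \<ge> m + N"
    have "real N \<le> 2 ^ (n - m)"
      using n of_nat_less_two_power[of "n - m", where 'a = real] by linarith
    then have "real N * R \<le> 2 ^ (n - m) * norm ((f ^^ m) z)"
      using m R_pos by (intro mult_mono) auto
    also have "\<dots> \<le> norm ((f ^^ (n - m)) ((f ^^ m) z))"
      using iterate_norm_ge[OF m] .
    also have "\<dots> = norm ((f ^^ n) z)"
      using n by (simp flip: funpow_add[THEN fun_cong, unfolded o_def])
    finally show "norm ((f ^^ n) z) > B"
      using N R_pos by (simp add: field_simps)
  qed
qed

lemma K_iterate_iff: "(f ^^ n) z \<in> K \<longleftrightarrow> z \<in> K"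
proof
  assume "(f ^^ n) z \<in> K"
  then have *: "norm ((f ^^ (k + n)) z) \<le> R" for k
    by (simp add: K_def funpow_add)
  have "norm ((f ^^ k) z) \<le> R" for k
    using *[of k] iterate_escapes_mono[of k z "k + n"] by (meson le_add1 not_le)
  then show "z \<in> K" by (simp add: K_def)
next
  assume "z \<in> K"
  then have "norm ((f ^^ (k + n)) z) \<le> R" for k
    by (simp add: K_def)
  then show "(f ^^ n) z \<in> K"
    by (simp add: K_def funpow_add)
qed

lemma K_image_iff: "f z \<in> K \<longleftrightarrow> z \<in> K"
  using K_iterate_iff[of 1] by simp

lemma K_subset_cball: "K \<subseteq> cball 0 R"
  by (auto simp: K_def dest: spec[of _ 0])

lemma closed_K: "closed K"
proof -
  have "K = (\<Inter>n. (f ^^ n) -` cball 0 R)"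
    by (auto simp: K_def)
  also have "closed \<dots>"
    by (intro closed_INT ballI closed_vimage continuous_iterate) auto
  finally show ?thesis .
qed

lemma compact_K: "compact K"
  using closed_K bounded_subset[OF bounded_cball K_subset_cball] by (simp add: compact_eq_bounded_closed)

lemma frontier_K_subset: "frontier K \<subseteq> K"
  using closed_K by (rule frontier_subset_closed)

text \<open>Near a boundary point of \<open>K\<close> the iterates are not locally bounded. By Schottky's theorem they
  cannot all omit both preimages \<open>u\<close> and \<open>v\<close> of \<open>y\<close>.\<close>

lemma frontier_K_preimages:
  assumes z: "z \<in> frontier K" and e: "e > 0" and uv: "f u = y" "f v = y" "u \<noteq> v"
  shows "\<forall>\<^sub>F n in sequentially. \<exists>x. dist x z < e \<and> (f ^^ n) x = y"
proof (rule ccontr)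
  assume "\<not> ?thesis"
  then have "\<exists>\<^sub>\<infinity>n. \<not> (\<exists>x. dist x z < e \<and> (f ^^ n) x = y)"
    by (simp add: not_eventually cofinite_eq_sequentially)
  then have inf: "\<exists>n>k. \<not> (\<exists>x. dist x z < e \<and> (f ^^ n) x = y)" for k
    by (simp add: INFM_nat)
  \<comment> \<open>The affine change of coordinates sends \<open>u\<close> and \<open>v\<close> to
    0 and 1, the values omitted in \<open>GPicard1\<close>. If iterate \<open>Suc m\<close> omits
    \<open>y\<close>, iterate \<open>m\<close> omits both preimages.\<close>
  define h where "h m w = ((f ^^ m) w - u) / (v - u)" for m w
  define X where "X = h ` {m. \<not> (\<exists>x. dist x z < e \<and> (f ^^ Suc m) x = y)}"
  have hol: "g holomorphic_on ball z e" if "g \<in> X" for g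
    using that uv(3) unfolding X_def h_def
    by (auto intro!: holomorphic_intros holomorphic_iterate)
  have omit: "g w \<noteq> 0 \<and> g w \<noteq> 1" if "g \<in> X" "w \<in> ball z e" for g w
    using that uv unfolding X_def h_def by (auto simp: dist_commute)
  have bound: "norm (g z) \<le> (R + norm u) / norm (v - u)" if g: "g \<in> X" for g
  proof -
    obtain m where m: "g = h m" using g by (auto simp: X_def)
    have "norm ((f ^^ m) z) \<le> R"
      using z frontier_K_subset by (auto simp: K_def)
    then have "norm ((f ^^ m) z - u) \<le> R + norm u"
      using norm_triangle_ineq4[of "(f ^^ m) z" u] by linarith
    then show ?thesis
      by (simp add: m h_def norm_divide divide_right_mono)
  qed
  have pos: "0 < (R + norm u) / norm (v - u)"
    using R_pos uv(3) by (simp add: add_pos_nonneg)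
  obtain B Z where B: "0 < B" "open Z" "z \<in> Z" "Z \<subseteq> ball z e" "\<And>g w. g \<in> X \<Longrightarrow> w \<in> Z \<Longrightarrow> norm (g w) \<le> B"
    by (rule GPicard1[of "ball z e" z "(R + norm u) / norm (v - u)" X X])
      (use e pos hol omit bound in auto)
  \<comment> \<open>At such a point the iterates tend to infinity, against the uniform bound
    \<open>B\<close> on the neighbourhood \<open>Z\<close>.\<close>
  obtain w where w: "w \<in> Z" "w \<notin> K"
  proof -
    obtain d where d: "d > 0" "ball z d \<subseteq> Z"
      using B(2,3) by (meson openE)
    then obtain w where "w \<notin> K" "dist z w < d"
      using z unfolding frontier_straddle by blast
    with d(2) show ?thesis
      by (intro that[of w]) auto
  qed
  obtain k where k: "\<And>n. n \<ge> k \<Longrightarrow> norm ((f ^^ n) w) > B * norm (v - u) + norm u"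
    using not_K_unbounded[OF w(2)] by metis
  obtain n where n: "n > k" "\<not> (\<exists>x. dist x z < e \<and> (f ^^ n) x = y)"
    using inf by blast
  then obtain m where m: "n = Suc m" "m \<ge> k"
    by (cases n) auto
  then have "h m \<in> X"
    using n by (auto simp: X_def)
  from B(5)[OF this w(1)] have "norm ((f ^^ m) w - u) \<le> B * norm (v - u)"
    using uv(3) by (simp add: h_def norm_divide field_simps)
  with k[OF m(2)] norm_triangle_ineq2[of "(f ^^ m) w" u] show False
    by linarith
qed

text \<open>Escape is an open condition: if \<open>z\<close> leaves the disc after \<open>m\<close>
  steps, so does \<open>x k\<close> for large \<open>k\<close>, and then it cannot land on
  \<open>y\<close> at the later time \<open>s k\<close>.\<close>

lemma limit_of_preimages_in_K:
  assumes s: "strict_mono s" and x: "\<And>k. (f ^^ s k) (x k) = y" "x \<longlonglongrightarrow> z" and y: "norm y \<le> R"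
  shows "z \<in> K"
proof (rule ccontr)
  assume "z \<notin> K"
  then obtain m where m: "norm ((f ^^ m) z) > R"
    by (auto simp: K_def not_le)
  have "(\<lambda>k. norm ((f ^^ m) (x k))) \<longlonglongrightarrow> norm ((f ^^ m) z)"
    by (intro tendsto_norm continuous_on_tendsto_compose[OF continuous_iterate[of UNIV] x(2)]) auto
  then have "\<forall>\<^sub>F k in sequentially. norm ((f ^^ m) (x k)) > R"
    using m by (rule order_tendstoD)
  then obtain k where "norm ((f ^^ m) (x k)) > R" "k \<ge> m"
    using eventually_conj[OF _ eventually_ge_at_top[of m]] eventually_happens trivial_limit_sequentially
    by (metis (mono_tags, lifting))
  moreover have "m \<le> s k"
    using \<open>k \<ge> m\<close> strict_mono_imp_increasing[OF s, of k] by linarith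
  ultimately show False
    using iterate_escapes_mono[of m "x k" "s k"] x(1)[of k] y by simp
qed

text \<open>Cauchy's estimate: on a disc inside \<open>K\<close> every iterate is bounded by
  \<open>R\<close>, so on the disc of half the radius the derivatives are bounded independently of
  \<open>n\<close>.\<close>

lemma equicontinuous_interior_K:
  assumes "w \<in> interior K"
  obtains d L where "d > 0" "ball w d \<subseteq> K" "\<And>n. norm (deriv (f ^^ n) w) \<le> L"
    "\<And>n x x'. x \<in> ball w d \<Longrightarrow> x' \<in> ball w d \<Longrightarrow> dist ((f ^^ n) x) ((f ^^ n) x') \<le> L * dist x x'"
proof -
  obtain e where e: "e > 0" "cball w e \<subseteq> K"
    using assms by (auto simp: mem_interior_cball)
  have D: "norm (deriv (f ^^ n) u) \<le> R / (e / 2)" if "u \<in> ball w (e / 2)" for n u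
  proof -
    have "norm ((deriv ^^ 1) (f ^^ n) u) \<le> fact 1 * R / (e / 2) ^ 1"
    proof (rule Cauchy_inequality)
      fix x assume "norm (u - x) = e / 2"
      then have "x \<in> cball w e"
        using that dist_triangle[of w x u] by (simp add: dist_norm)
      with e(2) show "norm ((f ^^ n) x) \<le> R"
        by (auto simp: K_def)
    qed (use e in \<open>auto intro: holomorphic_iterate continuous_iterate\<close>)
    then show ?thesis by simp
  qed
  show thesis
  proof
    show "ball w (e / 2) \<subseteq> K"
      using e by (auto simp: subset_iff)
    show "dist ((f ^^ n) x) ((f ^^ n) x') \<le> R / (e / 2) * dist x x'"
      if "x \<in> ball w (e / 2)" "x' \<in> ball w (e / 2)" for n x x'
      unfolding dist_norm
    proof (rule field_differentiable_bound[OF convex_ball])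
      fix u assume u: "u \<in> ball w (e / 2)"
      show "((f ^^ n) has_field_derivative deriv (f ^^ n) u) (at u within ball w (e / 2))"
        using holomorphic_derivI[OF holomorphic_iterate open_ball u] .
      show "norm (deriv (f ^^ n) u) \<le> R / (e / 2)"
        using u by (rule D)
    qed (use that in auto)
  qed (use e D in auto)
qed

lemma open_iterate_image:
  assumes "open U" "U \<noteq> {}"
  shows "open ((f ^^ n) ` U)"
proof (rule open_mapping_thm[of _ UNIV])
  show "\<not> (f ^^ n) constant_on UNIV"
  proof
    assume "(f ^^ n) constant_on UNIV"
    then obtain c where c: "\<And>z. (f ^^ n) z = c"
      by (auto simp: constant_on_def)
    define t :: complex where "t = of_real (R + norm c + 1)"
    have t: "norm t = R + norm c + 1"
      using R_pos unfolding t_def by (simp only: norm_of_real) simp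
    have "1 * norm t \<le> 2 ^ n * norm t"
      by (intro mult_right_mono) auto
    also have "\<dots> \<le> norm ((f ^^ n) t)"
      by (intro iterate_norm_ge) (use norm_ge_zero[of c] in \<open>simp only: t\<close>)
    finally show False
      using R_pos by (simp add: t c)
  qed
qed (use assms holomorphic_iterate in auto)

text \<open>Openness of the iterates puts \<open>y\<close> in the interior. Equicontinuity at
  \<open>z\<close> replaces \<open>x k\<close> by \<open>z\<close>, so the orbit of \<open>z\<close>
  is close to \<open>y\<close> at the times \<open>s k\<close> and \<open>s (Suc k)\<close>;
  equicontinuity at \<open>y\<close> then shows that the iterate by the difference of these times
  hardly moves \<open>y\<close>.\<close>

lemma limit_of_preimages_interior_K:
  assumes s: "strict_mono s" and x: "\<And>k. (f ^^ s k) (x k) = y" "x \<longlonglongrightarrow> z" and z: "z \<in> interior K"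
  shows "y \<in> interior K" and "e > 0 \<Longrightarrow> \<exists>n>0. dist ((f ^^ n) y) y < e"
proof -
  have "\<forall>\<^sub>F k in sequentially. x k \<in> interior K"
    using x(2) z by (simp add: topological_tendstoD)
  then obtain k where "x k \<in> interior K"
    using eventually_happens trivial_limit_sequentially by blast
  then have "y \<in> (f ^^ s k) ` interior K"
    using x(1) by force
  moreover have "(f ^^ s k) ` interior K \<subseteq> K"
    using interior_subset K_iterate_iff by blast
  moreover have "open ((f ^^ s k) ` interior K)"
    using z by (intro open_iterate_image) auto
  ultimately show y: "y \<in> interior K"
    by (meson interior_maximal subsetD)
  obtain d L where dL: "d > 0" "ball z d \<subseteq> K" "\<And>n. norm (deriv (f ^^ n) z) \<le> L"
    "\<And>n x x'. x \<in> ball z d \<Longrightarrow> x' \<in> ball z d \<Longrightarrow> dist ((f ^^ n) x) ((f ^^ n) x') \<le> L * dist x x'"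
    using equicontinuous_interior_K[OF z] by metis
  obtain d' L' where dL': "d' > 0" "ball y d' \<subseteq> K" "\<And>n. norm (deriv (f ^^ n) y) \<le> L'"
    "\<And>n x x'. x \<in> ball y d' \<Longrightarrow> x' \<in> ball y d' \<Longrightarrow> dist ((f ^^ n) x) ((f ^^ n) x') \<le> L' * dist x x'"
    using equicontinuous_interior_K[OF y] by metis
  have lim0: "(\<lambda>k. L * dist z (x k)) \<longlonglongrightarrow> 0"
    using tendsto_mult_right_zero[OF tendsto_dist[OF tendsto_const x(2), of z, simplified], of L] .
  have "\<forall>\<^sub>F k in sequentially. x k \<in> ball z d"
    using tendstoD[OF x(2) dL(1)] by (simp add: dist_commute)
  then have ev: "\<forall>\<^sub>F k in sequentially. norm (dist ((f ^^ s k) z) y) \<le> L * dist z (x k)"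
  proof eventually_elim
    case (elim k)
    with dL(4)[of z "x k" "s k"] dL(1) x(1)[of k] show ?case by simp
  qed
  from ev lim0 have lim: "(\<lambda>k. dist ((f ^^ s k) z) y) \<longlonglongrightarrow> 0"
    by (rule Lim_null_comparison)
  assume e: "e > 0"
  have L': "L' \<ge> 0"
    using dL'(3)[of 0] norm_ge_zero order_trans by blast
  \<comment> \<open>Small enough to stay in the disc around \<open>y\<close>, and with
    \<open>(L' + 1) * e' \<le> e\<close> for the two errors \<open>L' * e'\<close> and
    \<open>e'\<close>.\<close>
  define e' where "e' = min d' (e / (L' + 1))"
  have e': "e' > 0"
    using e L' dL'(1) by (simp add: e'_def)
  then have "\<forall>\<^sub>F k in sequentially. dist ((f ^^ s k) z) y < e'"
    using lim by (rule order_tendstoD(2)[rotated])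
  then obtain k where k: "\<And>l. l \<ge> k \<Longrightarrow> dist ((f ^^ s l) z) y < e'"
    by (auto simp: eventually_sequentially)
  define n where "n = s (Suc k) - s k"
  have n: "s (Suc k) = n + s k" "n > 0"
    using strict_monoD[OF s, of k "Suc k"] by (auto simp: n_def)
  have "dist ((f ^^ n) y) ((f ^^ n) ((f ^^ s k) z)) \<le> L' * dist y ((f ^^ s k) z)"
    by (rule dL'(4)) (use k[of k] dL'(1) in \<open>auto simp: dist_commute e'_def\<close>)
  also have "\<dots> \<le> L' * e'"
    using k[of k] L' by (intro mult_left_mono) (auto simp: dist_commute)
  finally have "dist ((f ^^ n) y) y < L' * e' + e'"
    using dist_triangle[of "(f ^^ n) y" y "(f ^^ s (Suc k)) z"] k[of "Suc k"]
    by (simp add: n(1) funpow_add)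
  also have "\<dots> = (L' + 1) * e'"
    by (simp add: algebra_simps)
  also have "\<dots> \<le> (L' + 1) * (e / (L' + 1))"
    using L' by (intro mult_left_mono) (auto simp: e'_def)
  also have "\<dots> = e"
    using L' by simp
  finally show "\<exists>n>0. dist ((f ^^ n) y) y < e"
    using n(2) by blast
qed

text \<open>By the chain rule the iterates have the powers of the multiplier as derivatives at the
  fixed point, and these stay bounded by equicontinuity.\<close>

lemma interior_K_multiplier:
  assumes y: "y \<in> interior K" "f y = y"
  shows "norm (deriv f y) \<le> 1"
proof (rule ccontr)
  assume gt: "\<not> norm (deriv f y) \<le> 1"
  obtain d L where L: "\<And>n. norm (deriv (f ^^ n) y) \<le> L"
    using equicontinuous_interior_K[OF y(1)] by metis
  have fp: "(f ^^ n) y = y" for n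
    using y(2) by (induction n) auto
  have "((f ^^ n) has_field_derivative deriv f y ^ n) (at y)" for n
  proof (induction n)
    case (Suc n)
    have "(f has_field_derivative deriv f y) (at ((f ^^ n) y))"
      using holo by (simp add: fp holomorphic_derivI)
    from DERIV_chain[OF this Suc] show ?case
      by (simp add: o_def)
  qed (simp add: id_def)
  then have D: "deriv (f ^^ n) y = deriv f y ^ n" for n
    by (rule DERIV_imp_deriv)
  obtain n where "L < norm (deriv f y) ^ n"
    using gt real_arch_pow[of "norm (deriv f y)" L] by auto
  then show False
    using L[of n] by (simp add: D norm_power)
qed

text \<open>Near \<open>y\<close> the difference quotient has modulus below 1, so a small disc is
  mapped into itself and its orbits are bounded.\<close>

lemma attracting_in_interior_K:
  assumes "f y = y" "(f has_field_derivative D) (at y)" "norm D < 1"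
  shows "y \<in> interior K"
proof -
  have "(\<lambda>w. (f w - f y) / (w - y)) \<midarrow>y\<rightarrow> D"
    using assms(2) by (simp add: has_field_derivative_iff)
  then have "(\<lambda>w. norm ((f w - f y) / (w - y))) \<midarrow>y\<rightarrow> norm D"
    by (rule tendsto_norm)
  then have "\<forall>\<^sub>F w in at y. norm ((f w - f y) / (w - y)) < 1"
    using assms(3) by (rule order_tendstoD)
  then obtain d where d: "d > 0" "\<And>w. w \<noteq> y \<Longrightarrow> dist w y < d \<Longrightarrow> norm ((f w - f y) / (w - y)) < 1"
    by (auto simp: eventually_at)
  have step: "f w \<in> ball y d" if "w \<in> ball y d" for w
  proof (cases "w = y")
    case False
    with d(2)[of w] that have "norm (f w - y) < norm (w - y)"
      using assms(1) by (simp add: norm_divide dist_commute)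
    with that show ?thesis
      by (simp add: dist_norm norm_minus_commute)
  qed (use d assms in auto)
  have "ball y d \<subseteq> K"
  proof
    fix w assume w: "w \<in> ball y d"
    have it: "(f ^^ n) w \<in> ball y d" for n
      by (induction n) (use w step in auto)
    have "norm ((f ^^ n) w) \<le> norm y + d" for n
      using it[of n] norm_triangle_ineq2[of "(f ^^ n) w" y] by (simp add: dist_norm norm_minus_commute)
    then show "w \<in> K" by (rule K_memI)
  qed
  then show ?thesis
    using d(1) by (auto simp: mem_interior)
qed


text \<open>The cubic coefficient of the iterates of \<open>f \<circ> f\<close> grows linearly, whereas it is bounded at
  interior points by the maximum principle.\<close>

lemma parabolic_not_in_interior_K:
  assumes g: "\<And>u. f (f (y + u)) = y + u - k * u ^ 3 + u ^ 4 * h u"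
    and h: "h holomorphic_on UNIV" and k: "k \<noteq> 0"
  shows "y \<notin> interior K"
proof
  assume "y \<in> interior K"
  then obtain d where d: "d > 0" "cball y d \<subseteq> K"
    by (auto simp: mem_interior_cball)
  have "\<exists>H. H holomorphic_on UNIV \<and>
          (\<forall>u. (f ^^ (2 * n)) (y + u) = y + u - of_nat n * k * u ^ 3 + u ^ 4 * H u)" for n
  proof (induction n)
    case 0
    show ?case by (intro exI[of _ "\<lambda>_. 0"]) auto
  next
    case (Suc n)
    then obtain H where H: "H holomorphic_on UNIV"
      "\<And>u. (f ^^ (2 * n)) (y + u) = y + u - of_nat n * k * u ^ 3 + u ^ 4 * H u"
      by blast
    \<comment> \<open>\<open>w u\<close> is the displacement from \<open>y\<close> after
      \<open>2 * n\<close> steps. As \<open>A u = u * B u\<close>, replacing \<open>u\<close> by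
      \<open>w u\<close> in the cubic term changes it only by order four, and the change is absorbed
      in \<open>H'\<close>.\<close>
    define A where "A u = - of_nat n * k * u\<^sup>2 + u ^ 3 * H u" for u
    define B where "B u = - of_nat n * k * u + u\<^sup>2 * H u" for u
    define w where "w u = u * (1 + A u)" for u
    define H' where "H' u = H u - k * (3 * B u + 3 * B u * A u + B u * (A u)\<^sup>2) + (1 + A u) ^ 4 * h (w u)" for u
    have hol: "A holomorphic_on UNIV" "B holomorphic_on UNIV" "w holomorphic_on UNIV"
      unfolding A_def B_def w_def by (intro holomorphic_intros H)+
    then have "(h \<circ> w) holomorphic_on UNIV"
      by (intro holomorphic_on_compose holomorphic_on_subset[OF h]) auto
    then have "H' holomorphic_on UNIV"
      unfolding H'_def o_def by (intro holomorphic_intros H hol)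
    moreover have "(f ^^ (2 * Suc n)) (y + u) = y + u - of_nat (Suc n) * k * u ^ 3 + u ^ 4 * H' u" for u
    proof -
      have AB: "A u = u * B u"
        by (simp add: A_def B_def algebra_simps power2_eq_square power3_eq_cube)
      have wu: "w u = u - of_nat n * k * u ^ 3 + u ^ 4 * H u"
        by (simp add: w_def A_def algebra_simps power2_eq_square power3_eq_cube power4_eq_xxxx)
      have "(f ^^ (2 * n)) (y + u) = y + w u"
        unfolding H(2) wu by simp
      moreover have "2 * Suc n = Suc (Suc (2 * n))"
        by simp
      ultimately have "(f ^^ (2 * Suc n)) (y + u) = y + w u - k * w u ^ 3 + w u ^ 4 * h (w u)"
        by (simp only: funpow.simps o_apply g)
      also have "\<dots> = y + w u - k * u ^ 3 - k * u ^ 3 * (3 * A u + 3 * (A u)\<^sup>2 + A u ^ 3) + u ^ 4 * ((1 + A u) ^ 4 * h (w u))"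
        unfolding w_def by (simp add: algebra_simps power2_eq_square power3_eq_cube power4_eq_xxxx)
      also have "k * u ^ 3 * (3 * A u + 3 * (A u)\<^sup>2 + A u ^ 3) = u ^ 4 * (k * (3 * B u + 3 * B u * A u + B u * (A u)\<^sup>2))"
        unfolding AB by (simp add: algebra_simps power2_eq_square power3_eq_cube power4_eq_xxxx)
      also have "y + w u - k * u ^ 3 - u ^ 4 * p + u ^ 4 * p'
          = y + u - of_nat (Suc n) * k * u ^ 3 + u ^ 4 * (H u - p + p')" for p p'
        by (simp add: wu algebra_simps)
      finally show ?thesis
        unfolding H'_def .
    qed
    ultimately show ?case by blast
  qed
  then obtain H where H: "\<And>n. H n holomorphic_on UNIV"
    "\<And>n u. (f ^^ (2 * n)) (y + u) = y + u - of_nat n * k * u ^ 3 + u ^ 4 * H n u"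
    by metis
  have bound: "real n * norm k \<le> (R + norm y + d) / d ^ 3" for n
  proof -
    \<comment> \<open>Displacement minus \<open>u\<close>, divided by \<open>u ^ 3\<close>, extends
      to an entire function whose value at 0 is minus \<open>n * k\<close>. On the circle
      \<open>norm u = d\<close> it is bounded because the iterate stays in the disc of radius
      \<open>R\<close>.\<close>
    have "norm (- of_nat n * k + 0 * H n 0) \<le> (R + norm y + d) / d ^ 3"
    proof (rule maximum_modulus_frontier[of "\<lambda>u. - of_nat n * k + u * H n u" "cball 0 d"])
      show "(\<lambda>u. - of_nat n * k + u * H n u) holomorphic_on interior (cball 0 d)"
        by (intro holomorphic_intros holomorphic_on_subset[OF H(1)]) auto
      show "continuous_on (closure (cball 0 d)) (\<lambda>u. - of_nat n * k + u * H n u)"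
        by (intro continuous_intros holomorphic_on_imp_continuous_on holomorphic_on_subset[OF H(1)]) auto
      fix u :: complex assume "u \<in> frontier (cball 0 d)"
      then have u: "norm u = d"
        using d(1) by simp
      have "y + u \<in> K"
        using d(2) u by (intro subsetD[OF d(2)]) (simp add: dist_norm)
      then have "norm ((f ^^ (2 * n)) (y + u)) \<le> R"
        by (simp add: K_def)
      moreover have "u ^ 3 * (- of_nat n * k + u * H n u) = (f ^^ (2 * n)) (y + u) - y - u"
        unfolding H(2) by (simp add: algebra_simps power3_eq_cube power4_eq_xxxx)
      then have "d ^ 3 * norm (- of_nat n * k + u * H n u) = norm ((f ^^ (2 * n)) (y + u) - y - u)"
        by (metis norm_mult norm_power u)
      ultimately have "d ^ 3 * norm (- of_nat n * k + u * H n u) \<le> R + norm y + d"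
        using norm_triangle_ineq4[of "(f ^^ (2 * n)) (y + u) - y" u]
          norm_triangle_ineq4[of "(f ^^ (2 * n)) (y + u)" y] u by linarith
      then show "norm (- of_nat n * k + u * H n u) \<le> (R + norm y + d) / d ^ 3"
        using d(1) by (simp add: field_simps)
    qed (use d in auto)
    then show ?thesis
      by (simp add: norm_mult)
  qed
  obtain n where "(R + norm y + d) / d ^ 3 / norm k < real n"
    using reals_Archimedean2 by blast
  then have "(R + norm y + d) / d ^ 3 < real n * norm k"
    using k by (metis pos_divide_less_eq zero_less_norm_iff)
  then show False
    using bound[of n] by linarith
qed

text \<open>In the coordinate \<open>1 / u\<^sup>2\<close> the second iterate is close to the translation by \<open>2 k\<close>, so
  a far right half plane is mapped into itself.\<close>

lemma parabolic_petal:
  assumes g: "\<And>u. f (f (y + u)) = y + u - of_real k * u ^ 3 + u ^ 4 * h u"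
    and h: "h holomorphic_on UNIV" and k: "k > 0"
  shows "interior K \<noteq> {}"
proof -
  define \<phi> where "\<phi> u = u - of_real k * u ^ 3 + u ^ 4 * h u" for u
  define q where "q u = 1 - of_real k * u\<^sup>2 + u ^ 3 * h u" for u
  have gphi: "f (f (y + u)) = y + \<phi> u" for u
    by (simp add: g \<phi>_def)
  have phiq: "\<phi> u = u * q u" for u
    by (simp add: \<phi>_def q_def algebra_simps power2_eq_square power3_eq_cube power4_eq_xxxx)
  have conth: "(h \<longlongrightarrow> h 0) (at 0)"
    using holomorphic_on_imp_continuous_on[OF h] by (simp add: continuous_on_def)
  have q1: "(q \<longlongrightarrow> 1) (at 0)"
    unfolding q_def by (rule tendsto_eq_rhs, (rule tendsto_intros conth)+) simp
  \<comment> \<open>For small nonzero \<open>u\<close> this expression is the increment of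
    \<open>1 / u^2\<close> under \<open>\<phi>\<close>; its limit \<open>2 * k\<close> gives it a
    positive real part near 0.\<close>
  have "((\<lambda>u. (of_real k - u * h u) * (1 + q u) / (q u)\<^sup>2) \<longlongrightarrow> of_real (2 * k)) (at 0)"
    by (rule tendsto_eq_rhs, (rule tendsto_intros conth q1)+) auto
  then have "((\<lambda>u. Re ((of_real k - u * h u) * (1 + q u) / (q u)\<^sup>2)) \<longlongrightarrow> 2 * k) (at 0)"
    using tendsto_Re by fastforce
  then have "\<forall>\<^sub>F u in at 0. Re ((of_real k - u * h u) * (1 + q u) / (q u)\<^sup>2) > 0"
    by (rule order_tendstoD(1)) (use k in simp)
  moreover have "\<forall>\<^sub>F u in at 0. q u \<noteq> 0"
    using q1 by (rule tendsto_imp_eventually_ne) simp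
  ultimately have "\<forall>\<^sub>F u in at 0. q u \<noteq> 0 \<and> Re ((of_real k - u * h u) * (1 + q u) / (q u)\<^sup>2) > 0"
    by eventually_elim simp
  then obtain d where d: "d > 0" "\<And>u. u \<noteq> 0 \<Longrightarrow> norm u < d \<Longrightarrow>
      q u \<noteq> 0 \<and> Re ((of_real k - u * h u) * (1 + q u) / (q u)\<^sup>2) > 0"
    by (auto simp: eventually_at dist_norm)
  \<comment> \<open>The preimage of a right half plane under \<open>1 / u^2\<close>; the bound
    \<open>1 / d^2\<close> forces \<open>norm u < d\<close>, where the increment has positive real
    part.\<close>
  define P where "P = {u. u \<noteq> 0 \<and> Re (1 / u\<^sup>2) > 1 / d\<^sup>2}"
  have P_norm: "norm u < d" if "u \<in> P" for u
  proof -
    have "1 / d\<^sup>2 < norm (1 / u\<^sup>2)"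
      using that complex_Re_le_cmod[of "1 / u\<^sup>2"] by (simp add: P_def)
    then have "(norm u)\<^sup>2 < d\<^sup>2"
      using that d(1) by (simp add: P_def norm_divide norm_power field_simps)
    then show ?thesis
      using d(1) by (simp add: power_less_imp_less_base)
  qed
  have P_step: "\<phi> u \<in> P" if u: "u \<in> P" for u
  proof -
    have u0: "u \<noteq> 0" using u by (simp add: P_def)
    have q: "q u \<noteq> 0" "Re ((of_real k - u * h u) * (1 + q u) / (q u)\<^sup>2) > 0"
      using d(2)[OF u0 P_norm[OF u]] by auto
    have "1 - (q u)\<^sup>2 = u\<^sup>2 * ((of_real k - u * h u) * (1 + q u))"
      by (simp add: q_def algebra_simps power2_eq_square power3_eq_cube)
    then have "1 / (\<phi> u)\<^sup>2 = 1 / u\<^sup>2 + (of_real k - u * h u) * (1 + q u) / (q u)\<^sup>2"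
      using u0 q(1) by (simp add: phiq field_simps power_mult_distrib)
    then have "Re (1 / (\<phi> u)\<^sup>2) = Re (1 / u\<^sup>2) + Re ((of_real k - u * h u) * (1 + q u) / (q u)\<^sup>2)"
      by (simp only: plus_complex.sel)
    then show ?thesis
      using u q u0 unfolding P_def phiq by simp
  qed
  have "(+) y ` P \<subseteq> K"
  proof (rule image_subsetI)
    fix u assume u: "u \<in> P"
    have even: "\<exists>v\<in>P. (f ^^ (2 * n)) (y + u) = y + v" for n
    proof (induction n)
      case (Suc n)
      then obtain v where "v \<in> P" "(f ^^ (2 * n)) (y + u) = y + v" by blast
      then show ?case
        by (intro bexI[of _ "\<phi> v"]) (simp_all add: gphi P_step)
    qed (use u in auto)
    have "norm ((f ^^ (2 * n)) (y + u)) \<le> max R (norm y + d)" for n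
    proof -
      obtain v where v: "v \<in> P" "(f ^^ (2 * n)) (y + u) = y + v"
        using even by blast
      then show ?thesis
        using norm_triangle_ineq[of y v] P_norm[of v] by simp
    qed
    then have *: "norm ((f ^^ n) (y + u)) \<le> max R (norm y + d)" if "even n" for n
      using that by (auto elim!: evenE)
    \<comment> \<open>The petal controls even iterates only. An odd iterate outside the disc would
      be at least doubled at the next even time, so it obeys the same bound.\<close>
    have "norm ((f ^^ n) (y + u)) \<le> max R (norm y + d)" for n
    proof (cases "norm ((f ^^ n) (y + u)) > R \<and> odd n")
      case True
      then have "norm ((f ^^ Suc n) (y + u)) \<ge> 2 * norm ((f ^^ n) (y + u))"
        using escape by simp
      moreover have "norm ((f ^^ Suc n) (y + u)) \<le> max R (norm y + d)"
        using *[of "Suc n"] True by simp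
      ultimately show ?thesis
        using norm_ge_zero[of "(f ^^ n) (y + u)"] by linarith
    qed (use *[of n] in auto)
    then show "y + u \<in> K"
      by (rule K_memI)
  qed
  moreover have "open P"
  proof -
    have "P = {u. u \<noteq> 0} \<inter> (\<lambda>u. Re (1 / u\<^sup>2)) -` {1 / d\<^sup>2 <..}"
      by (auto simp: P_def)
    also have "open \<dots>"
      by (rule continuous_open_preimage) (auto intro!: continuous_intros open_Collect_neq)
    finally show ?thesis .
  qed
  then have "open ((+) y ` P)"
    by (rule open_translation)
  moreover have "of_real (d / 2) \<in> P"
    using d(1) by (simp add: P_def field_simps flip: of_real_power)
  ultimately show ?thesis
    by (metis empty_iff image_eqI interior_maximal subset_empty)
qed

text \<open>A totally disconnected closed set does not separate the plane.\<close>

lemma not_totally_disconnected_supset: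
  assumes K: "interior K \<noteq> {}" and A: "frontier K \<subseteq> A"
  shows "\<not> totally_disconnected A"
proof
  assume td: "totally_disconnected A"
  have "\<not> connected (- frontier K)"
  proof
    assume conn: "connected (- frontier K)"
    have "- K \<noteq> {}"
      using compact_K not_compact_UNIV[where 'a = complex] by (metis Compl_empty_eq double_complement)
    moreover have "- K \<inter> - frontier K = - K" "interior K \<inter> - frontier K = interior K"
      "- frontier K \<subseteq> interior K \<union> - K"
      using closed_K interior_subset by (auto simp: frontier_def)
    moreover have "interior K \<inter> - K \<inter> - frontier K = {}"
      using interior_subset by auto
    ultimately show False
      using connectedD[OF conn, of "interior K" "- K"] K closed_K by auto
  qed
  moreover have "closed (frontier K)" by simp
  \<comment> \<open>A single component of the frontier already separates the plane. If
    \<open>A\<close> were totally disconnected, this component would be a point, and the complement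
    of a point is connected.\<close>
  ultimately obtain C where C: "C \<in> components (frontier K)" "\<not> connected (- C)"
    using separation_by_component_closed by blast
  have "connected C" "C \<noteq> {}" "C \<subseteq> A"
    using C(1) A in_components_connected in_components_nonempty in_components_subset by blast+
  then obtain D where "D \<in> components A" "C \<subseteq> D"
    using exists_component_superset by (metis subset_empty)
  then obtain x where "C \<subseteq> {x}"
    using td by (auto simp: totally_disconnected_def)
  with \<open>C \<noteq> {}\<close> have "C = {x}" by auto
  then show False
    using C(2) connected_punctured_universe[of x] by (simp add: Compl_eq_Diff_UNIV)
qed

text \<open>Each piece of a separation of the preimage is mapped onto \<open>C\<close>, since its
  image is open in \<open>C\<close> by the open mapping theorem and compact. Both pieces would thus
  contain a preimage of \<open>f c\<close>, although all of these lie in the connected set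
  \<open>I\<close>.\<close>

lemma connected_vimage:
  assumes C: "compact C" "connected C" and I: "connected I" "I \<subseteq> f -` C"
    and c: "f c \<in> C" "\<And>w. f w = f c \<Longrightarrow> w \<in> I" and bdd: "bounded (f -` C)"
  shows "connected (f -` C)"
proof (rule ccontr)
  assume "\<not> connected (f -` C)"
  moreover have "closed (f -` C)"
    using compact_imp_closed[OF C(1)] continuous_iterate[of UNIV 1] by (intro closed_vimage) auto
  ultimately obtain A B where AB: "closed A" "closed B" "f -` C = A \<union> B" "A \<inter> B = {}" "A \<noteq> {}" "B \<noteq> {}"
    unfolding connected_closed_set[OF \<open>closed (f -` C)\<close>] by blast
  have onto: "f ` A = C" if AB: "closed A" "closed B" "f -` C = A \<union> B" "A \<inter> B = {}" "A \<noteq> {}" for A B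
  proof -
    have "f ` A = f ` (- B) \<inter> C"
      using AB by auto
    moreover have "open (f ` (- B))"
      using open_iterate_image[of "- B" 1] AB by auto
    ultimately have "openin (top_of_set C) (f ` A)"
      by (auto simp: openin_open)
    moreover have "compact (f ` A)"
      using AB bdd continuous_iterate[of A 1] bounded_subset[of _ A]
      by (intro compact_continuous_image) (auto simp: compact_eq_bounded_closed)
    then have "closedin (top_of_set C) (f ` A)"
      using AB by (intro closed_subset) (auto intro: compact_imp_closed)
    ultimately show ?thesis
      using C(2) AB(5) by (metis connected_clopen image_is_empty)
  qed
  have "f ` A = C" "f ` B = C"
    using onto[of A B] onto[of B A] AB by auto
  then obtain a b where "a \<in> A" "b \<in> B" "f a = f c" "f b = f c"
    using c(1) by (metis imageE)
  then have "a \<in> I \<inter> A" "b \<in> I \<inter> B"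
    using c(2) by auto
  then show False
    using connected_closedD[OF I(1), of A B] AB I(2) by blast
qed

text \<open>The outside of a large disc is connected, so one piece of a separation would be bounded.
  Such a piece is mapped onto a set that is open and closed in \<open>V\<close>, hence onto
  \<open>V\<close>, which is unbounded.\<close>

lemma connected_vimage_unbounded:
  assumes V: "open V" "connected V" "\<not> bounded V" "- cball 0 r \<subseteq> f -` V"
  shows "connected (f -` V)"
proof (rule ccontr)
  assume "\<not> connected (f -` V)"
  moreover have op: "open (f -` V)"
    using V(1) continuous_iterate[of UNIV 1] by (intro open_vimage) auto
  ultimately obtain A B where AB: "open A" "open B" "f -` V = A \<union> B" "A \<inter> B = {}" "A \<noteq> {}" "B \<noteq> {}"
  proof -
    from \<open>\<not> connected (f -` V)\<close> obtain A B where "open A" "open B" "f -` V \<subseteq> A \<union> B"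
      "A \<inter> B \<inter> f -` V = {}" "A \<inter> f -` V \<noteq> {}" "B \<inter> f -` V \<noteq> {}"
      unfolding connected_def by blast
    then show ?thesis
      by (intro that[of "A \<inter> f -` V" "B \<inter> f -` V"] open_Int op) blast+
  qed
  have bounded_False: False
    if AB: "open A" "open B" "f -` V = A \<union> B" "A \<inter> B = {}" "B \<noteq> {}" and b: "bounded B" for A B
  proof -
    have "open (f ` B)"
      using open_iterate_image[of B 1] AB by auto
    then have "openin (top_of_set V) (f ` B)"
      using AB by (auto simp: openin_open)
    moreover have "closedin (top_of_set V) (f ` B)"
    proof -
      have "compact (f ` closure B)"
        using b continuous_iterate[of "closure B" 1] by (intro compact_continuous_image) auto
      moreover have "f ` B = V \<inter> f ` closure B"
      proof (intro equalityI subsetI)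
        fix y assume "y \<in> V \<inter> f ` closure B"
        then obtain x where x: "x \<in> closure B" "y = f x" "f x \<in> V" by auto
        then have "x \<in> A \<union> B" using AB by auto
        moreover have "x \<notin> A"
          using x(1) AB(1,4) by (metis disjoint_iff open_Int_closure_eq_empty)
        ultimately show "y \<in> f ` B" using x by auto
      next
        fix y assume "y \<in> f ` B"
        moreover have "B \<subseteq> f -` V"
          using AB(3) by simp
        ultimately show "y \<in> V \<inter> f ` closure B"
          using closure_subset[of B] by auto
      qed
      ultimately show ?thesis
        using compact_imp_closed by (auto simp: closedin_closed)
    qed
    ultimately have "f ` B = V"
      using V(2) AB(5) by (metis connected_clopen image_is_empty)
    moreover have "bounded (f ` closure B)"
      using b continuous_iterate[of "closure B" 1]
      by (intro compact_imp_bounded compact_continuous_image) auto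
    ultimately show False
      using V(3) by (metis bounded_subset closure_subset image_mono)
  qed
  have "connected (- cball 0 r :: complex set)"
    by (intro connected_complement_bounded_convex) auto
  then have "- cball 0 r \<subseteq> A \<or> - cball 0 r \<subseteq> B"
    using connectedD[of "- cball 0 r" A B] AB V(4) by blast
  then have "B \<subseteq> cball 0 r \<or> A \<subseteq> cball 0 r"
    using AB(4) by blast
  then have "bounded B \<or> bounded A"
    using bounded_subset[OF bounded_cball] by blast
  then show False
    using bounded_False[of A B] bounded_False[of B A] AB by auto
qed

text \<open>The invariant set \<open>I\<close> lies in every \<open>S n\<close>, so the preceding
  two lemmas apply at each step. Then \<open>K\<close> is a decreasing intersection of connected
  compact sets, its complement a union of connected sets with a common point, and a connected set
  with connected complement has a connected frontier.\<close>

lemma connected_frontier_K: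
  assumes I: "connected I" "f ` I \<subseteq> I" "bounded I" and c: "c \<in> I" "\<And>w. f w = f c \<Longrightarrow> w \<in> I"
  shows "connected (frontier K)"
proof -
  define S where "S n = (f ^^ n) -` cball 0 R" for n
  have S_Suc: "S (Suc n) = f -` S n" for n
    by (auto simp: S_def funpow_swap1)
  have S_mono: "S n \<subseteq> S m" if "m \<le> n" for m n
    using iterate_escapes_mono[OF _ that] by (force simp: S_def not_less)
  have S_sub: "S n \<subseteq> cball 0 R" for n
    using S_mono[of 0 n] by (simp add: S_def)
  have S_closed: "closed (S n)" for n
    unfolding S_def by (intro closed_vimage continuous_iterate) auto
  have S_compact: "compact (S n)" for n
    using S_closed bounded_subset[OF bounded_cball S_sub] by (simp add: compact_eq_bounded_closed)
  have K_eq: "K = (\<Inter>n. S n)"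
    by (auto simp: K_def S_def)
  have iter: "(f ^^ n) w \<in> I" if "w \<in> I" for w n
    using that I(2) by (induction n) auto
  obtain b where b: "\<And>w. w \<in> I \<Longrightarrow> norm w \<le> b"
    using I(3) by (auto simp: bounded_iff)
  have "I \<subseteq> K"
    using K_memI[of _ b] b iter by blast
  then have I_S: "I \<subseteq> S n" for n
    using K_eq by auto
  have "connected (S n)" for n
  proof (induction n)
    case 0
    then show ?case by (simp add: S_def)
  next
    case (Suc n)
    show ?case unfolding S_Suc
    proof (rule connected_vimage[OF S_compact Suc I(1)])
      show "I \<subseteq> f -` S n" using I_S[of "Suc n"] by (simp add: S_Suc)
      then show "f c \<in> S n" using c by auto
      show "bounded (f -` S n)" using compact_imp_bounded[OF S_compact[of "Suc n"]] by (simp add: S_Suc)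
    qed (use c in auto)
  qed
  then have "connected K"
    unfolding K_eq using S_compact S_mono by (intro connected_nest) auto
  moreover have "connected (- K)"
  proof -
    have "connected (- S n)" for n
    proof (induction n)
      case 0
      then show ?case
        by (simp add: S_def) (intro connected_complement_bounded_convex; auto)
    next
      case (Suc n)
      have eq: "- S (Suc n) = f -` (- S n)" by (auto simp: S_Suc)
      show ?case unfolding eq
      proof (rule connected_vimage_unbounded)
        show "open (- S n)" using S_closed by auto
        show "\<not> bounded (- S n)"
          using compact_imp_bounded[OF S_compact[of n]] not_bounded_UNIV[where 'a = complex]
          by (metis Compl_partition bounded_Un)
        show "- cball 0 R \<subseteq> f -` (- S n)" using S_sub[of "Suc n"] by (auto simp: S_Suc)
      qed (use Suc in auto)
    qed
    moreover have "- K = (\<Union>n. - S n)" by (auto simp: K_eq)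
    moreover have "of_real (R + 1) \<in> - S n" for n
    proof -
      have "of_real (R + 1) \<notin> (cball 0 R :: complex set)"
        using R_pos by (simp only: mem_cball_0 norm_of_real)
      then show ?thesis
        using S_sub[of n] by (meson ComplI subsetD)
    qed
    ultimately show ?thesis
      using connected_Union[of "range (\<lambda>n. - S n)"] by force
  qed
  ultimately show ?thesis
    by (rule connected_frontier_simple)
qed

end

section \<open>Real cubic maps with three real fixed points\<close>

text \<open>\<open>crit\<close> says that the two critical points are real and distinct,
  \<open>fixpts\<close> says the same of the two nonzero fixed points.\<close>

locale cubic_map =
  fixes a b c :: real
  assumes a_gt: "a > 1" and b_pos: "b > 0" and c_pos: "c > 0"
    and crit: "b\<^sup>2 > 3 * a * c" and fixpts: "b\<^sup>2 > 4 * c * (a - 1)"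
begin

definition f :: "complex \<Rightarrow> complex" where
  "f z = of_real a * z + of_real b * z\<^sup>2 + of_real c * z ^ 3"

definition rf :: "real \<Rightarrow> real" where
  "rf x = a * x + b * x\<^sup>2 + c * x ^ 3"

text \<open>Chosen so that \<open>c * r^2 - b * r - a \<ge> 2\<close> for \<open>r > R\<close>; the
  summand 1 ensures \<open>R > 1\<close>, so that -1 lies in the disc.\<close>

definition R :: real where
  "R = (a + b + 2) / c + 1"

lemma f_of_real: "f (of_real x) = of_real (rf x)"
  by (simp add: f_def rf_def)

lemma f_iterate_of_real: "(f ^^ n) (of_real x) = of_real ((rf ^^ n) x)"
  by (induction n) (simp_all add: f_of_real)

lemma R_gt: "R > 1"
  using a_gt b_pos c_pos by (simp add: R_def)

sublocale escaping_map f R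
proof
  show "f holomorphic_on UNIV"
    unfolding f_def by (intro holomorphic_intros)
  show "R > 0" using R_gt by simp
  fix z :: complex assume z: "norm z > R"
  define r where "r = norm z"
  have r: "r > 1" "r \<ge> (a + b + 2) / c"
    using z R_gt by (auto simp: r_def R_def)
  have "c * r \<ge> a + b + 2"
    using r(2) c_pos by (simp add: field_simps)
  then have "c * r * r \<ge> (a + b + 2) * r"
    using r(1) by (intro mult_right_mono) auto
  also have "(a + b + 2) * r \<ge> (a + 2) * 1 + b * r"
    using r(1) a_gt by (simp add: distrib_right) (simp add: algebra_simps add_mono mult_left_le)
  finally have 1: "c * r\<^sup>2 - b * r - a \<ge> 2"
    by (simp add: power2_eq_square)
  have "f z = of_real c * z ^ 3 - (- of_real b * z\<^sup>2 - of_real a * z)"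
    by (simp add: f_def)
  then have "norm (f z) \<ge> norm (of_real c * z ^ 3) - norm (- of_real b * z\<^sup>2 - of_real a * z)"
    by (metis norm_triangle_ineq2)
  moreover have "norm (- of_real b * z\<^sup>2 - of_real a * z) \<le> norm (- of_real b * z\<^sup>2) + norm (of_real a * z)"
    by (rule norm_triangle_ineq4)
  ultimately have "norm (f z) \<ge> c * r ^ 3 - (b * r\<^sup>2 + a * r)"
    using a_gt b_pos c_pos by (simp add: norm_mult norm_power r_def)
  also have "c * r ^ 3 - (b * r\<^sup>2 + a * r) = (c * r\<^sup>2 - b * r - a) * r"
    by (simp add: algebra_simps power2_eq_square power3_eq_cube)
  also have "\<dots> \<ge> 2 * r"
    using 1 r(1) by (intro mult_right_mono) auto
  finally show "2 * norm z \<le> norm (f z)"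
    by (simp add: r_def)
qed

section \<open>Real fixed points, their multipliers and escape along the real axis\<close>

definition p1 :: real where "p1 = (- b + sqrt (b\<^sup>2 - 4 * c * (a - 1))) / (2 * c)"
definition p2 :: real where "p2 = (- b - sqrt (b\<^sup>2 - 4 * c * (a - 1))) / (2 * c)"

lemma p_sum: "c * (p1 + p2) = - b"
  using c_pos by (simp add: p1_def p2_def field_simps)

lemma p_prod: "c * p1 * p2 = a - 1"
proof -
  have "(sqrt (b\<^sup>2 - 4 * c * (a - 1)))\<^sup>2 = b\<^sup>2 - 4 * c * (a - 1)"
    using fixpts by simp
  then show ?thesis
    using c_pos by (simp add: p1_def p2_def field_simps power2_eq_square)
qed

text \<open>The fixed points are abstracted to variables here, since \<open>p1\<close> and \<open>p2\<close> depend on \<open>a\<close> and \<open>b\<close>,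
  which would make the last two equations loop as rewrite rules.\<close>

lemma vieta:
  obtains u v where "p1 = u" "p2 = v" "b = - c * (u + v)" "a = 1 + c * u * v"
  using p_sum p_prod by (intro that[of p1 p2]) simp_all

lemma p2_less_p1: "p2 < p1"
  using c_pos fixpts by (simp add: p1_def p2_def divide_strict_right_mono)

lemma p1_neg: "p1 < 0"
proof -
  have "4 * c * (a - 1) > 0" using a_gt c_pos by simp
  then have "sqrt (b\<^sup>2 - 4 * c * (a - 1)) < sqrt (b\<^sup>2)"
    by (simp only: real_sqrt_less_iff)
  then show ?thesis
    using b_pos c_pos by (simp add: p1_def divide_neg_pos)
qed

lemma p2_neg: "p2 < 0"
  using p1_neg p2_less_p1 by simp

lemma p2_less: "p2 < - b / (2 * c)"
  unfolding p2_def by (rule divide_strict_right_mono) (use c_pos fixpts in simp_all)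

lemma p1_gt: "p1 > - b / (2 * c)"
  unfolding p1_def by (rule divide_strict_right_mono) (use c_pos fixpts in simp_all)

lemma rf_minus_id: "rf x - x = c * x * (x - p1) * (x - p2)"
proof -
  obtain u v where uv: "p1 = u" "p2 = v" "b = - c * (u + v)" "a = 1 + c * u * v"
    by (rule vieta)
  show ?thesis
    unfolding rf_def uv(1,2) unfolding uv(3,4)
    by (simp add: algebra_simps power2_eq_square power3_eq_cube)
qed

text \<open>To the right of \<open>p2\<close> the sign of the quadratic factor decides whether the
  image drops below \<open>p2\<close>. Its minimum \<open>1 - c * p1^2 / 4\<close>, attained at
  \<open>p1 / 2\<close>, is the origin of the comparison of \<open>c * p1^2\<close> with 4.\<close>

lemma rf_minus_p2: "rf x - p2 = (x - p2) * (c * x * (x - p1) + 1)"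
proof -
  obtain u v where uv: "p1 = u" "p2 = v" "b = - c * (u + v)" "a = 1 + c * u * v"
    by (rule vieta)
  show ?thesis
    unfolding rf_def uv(1,2) unfolding uv(3,4)
    by (simp add: algebra_simps power2_eq_square power3_eq_cube)
qed

lemma rf_p1: "rf p1 = p1" and rf_p2: "rf p2 = p2" and rf_0: "rf 0 = 0"
  using rf_minus_id[of p1] rf_minus_id[of p2] rf_minus_id[of 0] by simp_all

lemma fixpoint_in_K:
  assumes "rf x = x" shows "of_real x \<in> K"
proof -
  have "(rf ^^ n) x = x" for n
    using assms by (induction n) auto
  then show ?thesis
    by (intro K_memI[of _ "\<bar>x\<bar>"]) (simp add: f_iterate_of_real)
qed

lemma escape_right:
  assumes x: "x > 0" shows "of_real x \<notin> K"
proof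
  assume "of_real x \<in> K"
  then have le: "(rf ^^ n) x \<le> R" for n
    using abs_le_D1 by (auto simp: K_def f_iterate_of_real)
  have "(rf ^^ n) x \<ge> a ^ n * x" for n
  proof (induction n)
    case (Suc n)
    have "0 < a ^ n * x" using a_gt x by simp
    with Suc have pos: "(rf ^^ n) x > 0" by linarith
    have "a ^ Suc n * x \<le> a * (rf ^^ n) x"
      using Suc a_gt by simp
    also have "\<dots> \<le> rf ((rf ^^ n) x)"
      using pos b_pos c_pos by (simp add: rf_def)
    finally show ?case by simp
  qed simp
  then have "a ^ n * x \<le> R" for n
    using le order_trans by blast
  moreover obtain n where "R / x < a ^ n"
    using real_arch_pow a_gt by blast
  ultimately show False
    using x by (metis not_le pos_divide_less_eq)
qed

text \<open>The quadratic factor in \<open>rf_minus_p2\<close> grows as \<open>x\<close> moves left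
  from \<open>p2\<close>, and its value at \<open>p2\<close> is the multiplier there.\<close>

lemma rf_below_p2:
  assumes "x < p2"
  shows "p2 - rf x \<ge> (1 + c * p2 * (p2 - p1)) * (p2 - x)"
proof -
  have "- x * (p1 - x) \<ge> - p2 * (p1 - p2)"
    using assms p2_neg p2_less_p1 by (intro mult_mono) auto
  then have "c * (- x * (p1 - x)) \<ge> c * (- p2 * (p1 - p2))"
    using c_pos by (intro mult_left_mono) auto
  then have "1 + c * p2 * (p2 - p1) \<le> c * x * (x - p1) + 1"
    by (simp add: algebra_simps)
  then have "(1 + c * p2 * (p2 - p1)) * (p2 - x) \<le> (c * x * (x - p1) + 1) * (p2 - x)"
    using assms by (intro mult_right_mono) auto
  also have "\<dots> = p2 - rf x"
    using rf_minus_p2[of x] by (simp add: algebra_simps)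
  finally show ?thesis .
qed

lemma multiplier_p1: "a + 2 * b * p1 + 3 * c * p1\<^sup>2 = 1 + c * p1 * (p1 - p2)"
proof -
  obtain u v where uv: "p1 = u" "p2 = v" "b = - c * (u + v)" "a = 1 + c * u * v"
    by (rule vieta)
  show ?thesis
    unfolding uv(1,2) unfolding uv(3,4)
    by (simp add: algebra_simps power2_eq_square power3_eq_cube)
qed

lemma multiplier_p2: "a + 2 * b * p2 + 3 * c * p2\<^sup>2 = 1 + c * p2 * (p2 - p1)"
proof -
  obtain u v where uv: "p1 = u" "p2 = v" "b = - c * (u + v)" "a = 1 + c * u * v"
    by (rule vieta)
  show ?thesis
    unfolding uv(1,2) unfolding uv(3,4)
    by (simp add: algebra_simps power2_eq_square power3_eq_cube)
qed

lemma p2_repelling: "c * p2 * (p2 - p1) > 0"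
  using c_pos p2_neg p2_less_p1 by (simp add: mult_neg_neg mult_pos_neg)

lemma escape_left:
  assumes x: "x < p2" shows "of_real x \<notin> K"
proof
  define m where "m = 1 + c * p2 * (p2 - p1)"
  have m: "m > 1" using p2_repelling by (simp add: m_def)
  assume "of_real x \<in> K"
  then have "\<bar>(rf ^^ n) x\<bar> \<le> R" for n
    by (simp add: K_def f_iterate_of_real)
  then have ge: "(rf ^^ n) x \<ge> - R" for n
    using abs_le_D2[of "(rf ^^ n) x" R] by simp
  have "p2 - (rf ^^ n) x \<ge> m ^ n * (p2 - x)" for n
  proof (induction n)
    case (Suc n)
    have "0 < m ^ n * (p2 - x)" using m x by simp
    with Suc have "(rf ^^ n) x < p2" by linarith
    from rf_below_p2[OF this] have "p2 - rf ((rf ^^ n) x) \<ge> m * (p2 - (rf ^^ n) x)"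
      by (simp add: m_def)
    moreover have "m * (p2 - (rf ^^ n) x) \<ge> m * (m ^ n * (p2 - x))"
      using m Suc by (intro mult_left_mono) auto
    ultimately show ?case by simp
  qed simp
  then have "m ^ n * (p2 - x) \<le> p2 + R" for n
    using ge[of n] by (smt (verit))
  moreover obtain n where "(p2 + R) / (p2 - x) < m ^ n"
    using real_arch_pow m by blast
  ultimately show False
    using x by (metis diff_gt_0_iff_gt not_le pos_divide_less_eq)
qed

lemma zero_in_frontier: "0 \<in> frontier K"
  unfolding frontier_straddle
proof (intro allI impI conjI)
  fix e :: real assume "e > 0"
  then show "\<exists>x\<in>K. dist 0 x < e"
    using fixpoint_in_K[OF rf_0] by (intro bexI[of _ 0]) auto
  have "of_real (e / 2) \<notin> K" "dist 0 (of_real (e / 2) :: complex) < e"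
    using \<open>e > 0\<close> escape_right[of "e / 2"] by (simp_all add: dist_norm norm_divide)
  then show "\<exists>x. x \<notin> K \<and> dist 0 x < e" by blast
qed

lemma p2_in_frontier: "of_real p2 \<in> frontier K"
  unfolding frontier_straddle
proof (intro allI impI conjI)
  fix e :: real assume "e > 0"
  then show "\<exists>x\<in>K. dist (of_real p2) x < e"
    using fixpoint_in_K[OF rf_p2] by (intro bexI[of _ "of_real p2"]) auto
  have "of_real (p2 - e / 2) \<notin> K" "dist (of_real p2) (of_real (p2 - e / 2) :: complex) < e"
    using \<open>e > 0\<close> escape_left[of "p2 - e / 2"] by (simp_all only: dist_of_real) (simp_all add: dist_real_def)
  then show "\<exists>x. x \<notin> K \<and> dist (of_real p2) x < e" by blast
qed

section \<open>Preimages under the cubic\<close>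

lemma f_diff: "f z - f w = (z - w) * (of_real c * z\<^sup>2 + of_real (b) * z + of_real c * w * z
    + of_real a + of_real b * w + of_real c * w\<^sup>2)"
  by (simp add: f_def algebra_simps power2_eq_square power3_eq_cube)

lemma ex_preimage: "\<exists>z. f z = y"
proof -
  have "\<not> constant (poly [:- y, of_real a, of_real b, of_real c:])"
    using c_pos by (simp add: constant_degree)
  then obtain z where "poly [:- y, of_real a, of_real b, of_real c:] z = 0"
    using fundamental_theorem_of_algebra by blast
  then have "f z = y"
    by (simp add: f_def algebra_simps power2_eq_square power3_eq_cube)
  then show ?thesis ..
qed

text \<open>The map is not of the form \<open>c (z - u)\<^sup>3 + y\<close>, as \<open>b\<^sup>2 \<noteq> 3 a c\<close>.\<close>

lemma two_preimages:
  obtains u v where "f u = y" "f v = y" "u \<noteq> v"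
proof -
  obtain u where u: "f u = y" using ex_preimage by blast
  define C where "C = of_real a + of_real b * u + of_real c * u\<^sup>2"
  have "\<not> constant (poly [:C, of_real b + of_real c * u, of_real c:])"
    using c_pos by (simp add: constant_degree)
  then obtain v where v: "poly [:C, of_real b + of_real c * u, of_real c:] v = 0"
    using fundamental_theorem_of_algebra by blast
  have quad: "f z = y" if "C + (of_real b + of_real c * u) * z + of_real c * z\<^sup>2 = 0" for z
  proof -
    have "f z - f u = (z - u) * (C + (of_real b + of_real c * u) * z + of_real c * z\<^sup>2)"
      unfolding f_diff C_def by (simp add: algebra_simps)
    then show ?thesis using that u by simp
  qed
  have v0: "C + (of_real b + of_real c * u) * v + of_real c * v\<^sup>2 = 0"
    using v by (simp add: algebra_simps power2_eq_square)
  show thesis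
  proof (cases "v = u")
    case False
    then show ?thesis using that u quad[OF v0] by blast
  next
    case True
    \<comment> \<open>Here \<open>u\<close> is a double preimage; \<open>w\<close> is the other root
      of the quadratic, read off from the sum of its roots. If it also equalled \<open>u\<close>,
      then \<open>u = - b / (3 * c)\<close> would be critical, which forces
      \<open>b^2 = 3 * a * c\<close>.\<close>
    define w where "w = - (of_real b + 2 * of_real c * u) / of_real c"
    have cw: "of_real c * w = - (of_real b + 2 * of_real c * u)"
      using c_pos by (simp add: w_def)
    have "C + (of_real b + of_real c * u) * w + of_real c * w\<^sup>2
        = C + (of_real b + of_real c * u + of_real c * w) * w"
      by (simp add: algebra_simps power2_eq_square)
    also have "of_real b + of_real c * u + of_real c * w = - of_real c * u"
      unfolding cw by simp
    also have "C + - of_real c * u * w = C - u * (of_real c * w)"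
      by simp
    also have "\<dots> = 0"
      using v0 unfolding True cw by (simp add: algebra_simps power2_eq_square)
    finally have w: "f w = y" by (rule quad)
    have "w \<noteq> u"
    proof
      assume "w = u"
      then have "3 * of_real c * u = - of_real b"
        using cw by (simp add: algebra_simps)
      then have u_eq: "u = of_real (- b / (3 * c))"
        using c_pos by (simp add: field_simps)
      have "C + (of_real b + of_real c * u) * u + of_real c * u\<^sup>2 = of_real (a + 2 * b * (- b / (3 * c)) + 3 * c * (- b / (3 * c))\<^sup>2)"
        unfolding C_def u_eq by (simp add: algebra_simps power2_eq_square)
      with v0 True have "a + 2 * b * (- b / (3 * c)) + 3 * c * (- b / (3 * c))\<^sup>2 = 0"
        by (metis of_real_eq_0_iff)
      then have "b\<^sup>2 = 3 * a * c"
        using c_pos by (simp add: field_simps power2_eq_square)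
      then show False using crit by simp
    qed
    then show ?thesis using that u w by blast
  qed
qed

lemma deriv_f: "(f has_field_derivative of_real a + 2 * of_real b * z + 3 * of_real c * z\<^sup>2) (at z)"
  unfolding f_def by (rule derivative_eq_intros refl | simp)+

subsection \<open>Disconnectedness\<close>

text \<open>The preimage of the real axis consists of the real axis and the hyperbola \<open>c y\<^sup>2 = f' x\<close>, whose
  branches emanate from the critical points.\<close>

lemma hyperbola_value:
  assumes s: "a + 2 * b * s + 3 * c * s\<^sup>2 = 0"
    and y: "c * (Im z)\<^sup>2 = a + 2 * b * Re z + 3 * c * (Re z)\<^sup>2"
  shows "f z = of_real (rf s - 2 * c * (Re z - s) * (2 * (Re z - s) + (b / c + 3 * s))\<^sup>2)"
proof (rule complex_eqI)
  \<comment> \<open>In coordinates centred at the critical point, the derivative at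
    \<open>s + t\<close> is \<open>c * t * (3 * t + 2 * e)\<close>, which turns the equation of the
    hyperbola into a formula for \<open>(Im z)^2\<close>.\<close>
  define x t e where "x = Re z" and "t = x - s" and "e = b / c + 3 * s"
  have b: "b = c * (e - 3 * s)" and x: "x = s + t"
    using c_pos by (simp_all add: e_def t_def)
  have a: "a = c * (3 * s\<^sup>2 - 2 * e * s)"
    using s unfolding b by (simp add: algebra_simps power2_eq_square)
  have z: "z = Complex x (Im z)" by (simp add: x_def)
  have Re_f: "Re (f z) = rf x - (Im z)\<^sup>2 * (b + 3 * c * x)"
    unfolding f_def rf_def by (subst (1 2 3) z) (simp add: algebra_simps power2_eq_square power3_eq_cube)
  have Im_f: "Im (f z) = Im z * (a + 2 * b * x + 3 * c * x\<^sup>2 - c * (Im z)\<^sup>2)"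
    unfolding f_def by (subst (1 2 3) z) (simp add: algebra_simps power2_eq_square power3_eq_cube)
  show "Im (f z) = Im (of_real (rf s - 2 * c * (Re z - s) * (2 * (Re z - s) + (b / c + 3 * s))\<^sup>2))"
    using y by (simp add: Im_f x_def)
  have "c * (Im z)\<^sup>2 = c * (t * (3 * t + 2 * e))"
    using y unfolding x_def[symmetric] a b x by (simp add: algebra_simps power2_eq_square)
  then have y2: "(Im z)\<^sup>2 = t * (3 * t + 2 * e)"
    using c_pos by simp
  have "Re (f z) = rf s - 2 * c * t * (2 * t + e)\<^sup>2"
    unfolding Re_f y2 rf_def unfolding a b x by (simp add: algebra_simps power2_eq_square power3_eq_cube)
  then show "Re (f z) = Re (of_real (rf s - 2 * c * (Re z - s) * (2 * (Re z - s) + (b / c + 3 * s))\<^sup>2))"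
    by (simp add: t_def e_def x_def)
qed

text \<open>On the part of the hyperbola with \<open>Re z \<ge> s\<close>,
  \<open>hyperbola_value\<close> gives a real image that is at most \<open>rf s\<close>, hence left
  of \<open>p2\<close>. So \<open>A\<close> misses this part, which bounds a region \<open>U\<close>
  containing 0 but not \<open>p2\<close>.\<close>

lemma disconnected_if_right_escapes:
  assumes s: "a + 2 * b * s + 3 * c * s\<^sup>2 = 0" "p2 < s" "s < 0" "rf s < p2"
    and A: "A \<subseteq> K" "0 \<in> A" "of_real p2 \<in> A"
  shows "\<not> connected A"
proof
  assume conn: "connected A"
  define D where "D z = a + 2 * b * Re z + 3 * c * (Re z)\<^sup>2" for z
  define U where "U = {z. Re z > s} \<inter> {z. c * (Im z)\<^sup>2 < D z}"
  define V where "V = {z. Re z < s} \<union> {z. c * (Im z)\<^sup>2 > D z}"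
  have "open U" "open V"
    unfolding U_def V_def D_def
    by (intro open_Int open_Un open_Collect_less continuous_intros)+
  moreover have "A \<subseteq> U \<union> V"
  proof
    fix z assume "z \<in> A"
    then have "f z \<in> K" using A(1) K_image_iff by blast
    show "z \<in> U \<union> V"
    proof (rule ccontr)
      assume n: "z \<notin> U \<union> V"
      have Ds: "D z = 0" if "Re z = s"
        using s(1) that by (simp add: D_def)
      have "c * (Im z)\<^sup>2 \<ge> 0" using c_pos by simp
      then have z: "Re z \<ge> s" "c * (Im z)\<^sup>2 = D z"
        using n Ds by (force simp: U_def V_def)+
      then have "f z = of_real (rf s - 2 * c * (Re z - s) * (2 * (Re z - s) + (b / c + 3 * s))\<^sup>2)"
        using hyperbola_value[OF s(1), of z] by (simp add: D_def)
      moreover have "rf s - 2 * c * (Re z - s) * (2 * (Re z - s) + (b / c + 3 * s))\<^sup>2 < p2"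
        using s(4) c_pos z(1) by (smt (verit) mult_nonneg_nonneg zero_le_power2)
      ultimately show False
        using \<open>f z \<in> K\<close> escape_left by metis
    qed
  qed
  moreover have "U \<inter> V \<inter> A = {}" by (auto simp: U_def V_def)
  moreover have "0 \<in> U \<inter> A" "of_real p2 \<in> V \<inter> A"
    using A s a_gt by (auto simp: U_def V_def D_def)
  ultimately show False
    using connectedD[OF conn, of U V] by blast
qed

text \<open>The mirror image: for \<open>Re z \<le> s\<close> the image is at least
  \<open>rf s\<close>, hence positive. That \<open>p2\<close> lies in \<open>U\<close> follows from
  its positive multiplier.\<close>

lemma disconnected_if_left_escapes:
  assumes s: "a + 2 * b * s + 3 * c * s\<^sup>2 = 0" "p2 < s" "s < 0" "rf s > 0"
    and A: "A \<subseteq> K" "0 \<in> A" "of_real p2 \<in> A"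
  shows "\<not> connected A"
proof
  assume conn: "connected A"
  define D where "D z = a + 2 * b * Re z + 3 * c * (Re z)\<^sup>2" for z
  define U where "U = {z. Re z < s} \<inter> {z. c * (Im z)\<^sup>2 < D z}"
  define V where "V = {z. Re z > s} \<union> {z. c * (Im z)\<^sup>2 > D z}"
  have "open U" "open V"
    unfolding U_def V_def D_def
    by (intro open_Int open_Un open_Collect_less continuous_intros)+
  moreover have "A \<subseteq> U \<union> V"
  proof
    fix z assume "z \<in> A"
    then have "f z \<in> K" using A(1) K_image_iff by blast
    show "z \<in> U \<union> V"
    proof (rule ccontr)
      assume n: "z \<notin> U \<union> V"
      have Ds: "D z = 0" if "Re z = s"
        using s(1) that by (simp add: D_def)
      have "c * (Im z)\<^sup>2 \<ge> 0" using c_pos by simp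
      then have z: "Re z \<le> s" "c * (Im z)\<^sup>2 = D z"
        using n Ds by (force simp: U_def V_def)+
      then have "f z = of_real (rf s - 2 * c * (Re z - s) * (2 * (Re z - s) + (b / c + 3 * s))\<^sup>2)"
        using hyperbola_value[OF s(1), of z] by (simp add: D_def)
      moreover have "2 * c * (s - Re z) * (2 * (Re z - s) + (b / c + 3 * s))\<^sup>2 \<ge> 0"
        using c_pos z(1) by simp
      then have "rf s - 2 * c * (Re z - s) * (2 * (Re z - s) + (b / c + 3 * s))\<^sup>2 > 0"
        using s(4) by (simp add: algebra_simps)
      ultimately show False
        using \<open>f z \<in> K\<close> escape_right by metis
    qed
  qed
  moreover have "U \<inter> V \<inter> A = {}" by (auto simp: U_def V_def)
  moreover have "0 \<in> V \<inter> A"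
    using A s a_gt by (auto simp: V_def D_def)
  moreover have "of_real p2 \<in> U \<inter> A"
    using A s p2_repelling multiplier_p2 by (auto simp: U_def D_def)
  ultimately show False
    using connectedD[OF conn, of U V] by blast
qed

section \<open>Real critical points and critical values\<close>

definition s1 :: real where "s1 = (- b + sqrt (b\<^sup>2 - 3 * a * c)) / (3 * c)"
definition s2 :: real where "s2 = (- b - sqrt (b\<^sup>2 - 3 * a * c)) / (3 * c)"

lemma critical_points:
  "a + 2 * b * s1 + 3 * c * s1\<^sup>2 = 0" "a + 2 * b * s2 + 3 * c * s2\<^sup>2 = 0"
proof -
  define q where "q = sqrt (b\<^sup>2 - 3 * a * c)"
  have q: "q * q = b\<^sup>2 - 3 * a * c"
    using crit by (simp add: q_def)
  have *: "a + 2 * b * x + 3 * c * x\<^sup>2 = ((3 * c * x + b)\<^sup>2 - (b\<^sup>2 - 3 * a * c)) / (3 * c)" for x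
    using c_pos by (simp add: field_simps power2_eq_square)
  show "a + 2 * b * s1 + 3 * c * s1\<^sup>2 = 0" "a + 2 * b * s2 + 3 * c * s2\<^sup>2 = 0"
    using c_pos q unfolding * s1_def s2_def q_def[symmetric] by (simp_all add: power2_eq_square)
qed

lemma s1_bounds: "- b / (3 * c) < s1" "s1 < 0"
proof -
  show "- b / (3 * c) < s1"
    unfolding s1_def by (rule divide_strict_right_mono) (use c_pos crit in simp_all)
  have "3 * a * c > 0" using a_gt c_pos by simp
  then have "sqrt (b\<^sup>2 - 3 * a * c) < sqrt (b\<^sup>2)"
    by (simp only: real_sqrt_less_iff)
  then show "s1 < 0"
    using b_pos c_pos by (simp add: s1_def divide_neg_pos)
qed

lemma s2_bounds: "s2 < - b / (3 * c)" "s2 < 0"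
proof -
  show *: "s2 < - b / (3 * c)"
    unfolding s2_def by (rule divide_strict_right_mono) (use c_pos crit in simp_all)
  also have "\<dots> < 0"
    using b_pos c_pos by simp
  finally show "s2 < 0" .
qed

lemma p2_less_s1: "p2 < s1"
proof -
  have "- b / (2 * c) < - b / (3 * c)"
    using b_pos c_pos by (simp add: field_simps)
  then show ?thesis
    using p2_less s1_bounds by linarith
qed

text \<open>A critical point is a double root of the difference, so a linear factor alone compares
  \<open>rf x\<close> with the critical value.\<close>

lemma rf_minus_critical:
  assumes "a + 2 * b * s + 3 * c * s\<^sup>2 = 0"
  shows "rf x - rf s = (x - s)\<^sup>2 * (c * (x + 2 * s) + b)"
proof -
  have a: "a = - 2 * b * s - 3 * c * s\<^sup>2" using assms by simp
  show ?thesis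
    unfolding rf_def unfolding a by (simp add: algebra_simps power2_eq_square power3_eq_cube)
qed

text \<open>The test point is \<open>p1 / 2\<close>, where the quadratic factor of
  \<open>rf_minus_p2\<close> is least and now negative. By \<open>rf_minus_critical\<close> the
  critical value is no larger than the value at this point.\<close>

lemma rf_s1_less_p2:
  assumes "c * p1\<^sup>2 > 4"
  shows "rf s1 < p2"
proof -
  have "c * p1 > - b / 2"
    using p1_gt c_pos by (simp add: field_simps)
  moreover have "c * s1 > - b / 3"
    using s1_bounds c_pos by (simp add: field_simps)
  ultimately have "c * (p1 / 2 + 2 * s1) + b \<ge> 0"
    using b_pos by (simp add: algebra_simps)
  then have "rf (p1 / 2) - rf s1 \<ge> 0"
    unfolding rf_minus_critical[OF critical_points(1)] by simp
  moreover have "rf (p1 / 2) - p2 < 0"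
  proof -
    have "p1 / 2 - p2 > 0" using p1_neg p2_less_p1 by simp
    moreover have "c * (p1 / 2) * (p1 / 2 - p1) + 1 < 0"
      using assms by (simp add: power2_eq_square algebra_simps)
    ultimately show ?thesis
      unfolding rf_minus_p2 by (rule mult_pos_neg)
  qed
  ultimately show ?thesis by simp
qed

text \<open>This translates a condition on the coefficients into the position of
  \<open>c * p1^2\<close> and \<open>c * p2^2\<close> relative to 4.\<close>

lemma fixpoint_identity: "4 * b\<^sup>2 - (a + 3)\<^sup>2 * c = c * (4 - c * p1\<^sup>2) * (c * p2\<^sup>2 - 4)"
proof -
  obtain u v where uv: "p1 = u" "p2 = v" "b = - c * (u + v)" "a = 1 + c * u * v"
    by (rule vieta)
  show ?thesis
    unfolding uv(1,2) unfolding uv(3,4)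
    by (simp add: algebra_simps power2_eq_square power3_eq_cube)
qed

lemma p_squares: "c * p1\<^sup>2 < c * p2\<^sup>2" "(c * p1\<^sup>2) * (c * p2\<^sup>2) = (a - 1)\<^sup>2"
proof -
  have "(- p1)\<^sup>2 < (- p2)\<^sup>2"
    using p1_neg p2_less_p1 by (intro power_strict_mono) auto
  then show "c * p1\<^sup>2 < c * p2\<^sup>2" using c_pos by simp
  show "(c * p1\<^sup>2) * (c * p2\<^sup>2) = (a - 1)\<^sup>2"
    unfolding p_prod[symmetric] by (simp add: power2_eq_square)
qed

text \<open>A negative sign in \<open>fixpoint_identity\<close> puts both squares on the same side
  of 4. They cannot both be below, since their product \<open>(a - 1)^2\<close> is at least 16; this
  is where \<open>a \<ge> 5\<close> enters.\<close>

lemma p1_large: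
  assumes "a \<ge> 5" "4 * b\<^sup>2 < (a + 3)\<^sup>2 * c"
  shows "c * p1\<^sup>2 > 4"
proof (rule ccontr)
  assume le: "\<not> c * p1\<^sup>2 > 4"
  have "c * ((4 - c * p1\<^sup>2) * (c * p2\<^sup>2 - 4)) < 0"
    using assms(2) fixpoint_identity by simp
  then have "(4 - c * p1\<^sup>2) * (c * p2\<^sup>2 - 4) < 0"
    using c_pos by (simp add: mult_less_0_iff)
  with le have "c * p1\<^sup>2 < 4" "c * p2\<^sup>2 < 4"
    by (auto simp: mult_less_0_iff)
  then have "(c * p1\<^sup>2) * (c * p2\<^sup>2) < 4 * 4"
    using c_pos by (intro mult_strict_mono) auto
  moreover have "(a - 1)\<^sup>2 \<ge> 4\<^sup>2"
    using assms(1) by (intro power_mono) auto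
  ultimately show False using p_squares(2) by simp
qed

lemma p1_small:
  assumes "4 * b\<^sup>2 \<ge> (a + 3)\<^sup>2 * c"
  shows "c * p1\<^sup>2 \<le> 4"
proof (rule ccontr)
  assume "\<not> c * p1\<^sup>2 \<le> 4"
  then have "(4 - c * p1\<^sup>2) * (c * p2\<^sup>2 - 4) < 0"
    using p_squares(1) by (intro mult_neg_pos) auto
  then have "c * ((4 - c * p1\<^sup>2) * (c * p2\<^sup>2 - 4)) < 0"
    using c_pos by (simp add: mult_pos_neg)
  then show False using assms fixpoint_identity by simp
qed

lemma not_connected_of_escaping:
  assumes "a \<ge> 5 \<and> 4 * b\<^sup>2 < (a + 3)\<^sup>2 * c \<or> b\<^sup>2 > 4 * a * c" "A \<subseteq> K" "frontier K \<subseteq> A"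
  shows "\<not> connected A"
  using assms(1)
proof
  assume "a \<ge> 5 \<and> 4 * b\<^sup>2 < (a + 3)\<^sup>2 * c"
  then show ?thesis
    using disconnected_if_right_escapes[OF critical_points(1) p2_less_s1 s1_bounds(2)] rf_s1_less_p2 p1_large
      assms(2,3) zero_in_frontier p2_in_frontier by blast
next
  assume b: "b\<^sup>2 > 4 * a * c"
  \<comment> \<open>The vertex of the factor \<open>a + b * x + c * x^2\<close> of
    \<open>rf\<close>. The factor is negative there, so \<open>rf r > 0\<close>, and the critical
    value at \<open>s2\<close> is at least as large.\<close>
  define r where "r = - b / (2 * c)"
  have r: "r < 0" "2 * c * r = - b"
    using b_pos c_pos by (simp_all add: r_def)
  have "a + b * r + c * r\<^sup>2 = a - b\<^sup>2 / (4 * c)"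
    using c_pos by (simp add: r_def field_simps power2_eq_square)
  also have "\<dots> < 0"
    using b c_pos by (simp add: field_simps)
  finally have "r * (a + b * r + c * r\<^sup>2) > 0"
    using r by (simp add: mult_neg_neg)
  then have "rf r > 0"
    by (simp add: rf_def algebra_simps power2_eq_square power3_eq_cube)
  moreover have "c * s2 < - b / 3"
    using s2_bounds(1) c_pos by (simp add: field_simps)
  then have "c * (r + 2 * s2) + b \<le> 0"
    using r b_pos by (simp add: algebra_simps)
  then have "rf r - rf s2 \<le> 0"
    unfolding rf_minus_critical[OF critical_points(2)] by (simp add: mult_nonneg_nonpos)
  ultimately have pos: "rf s2 > 0" by simp
  \<comment> \<open>Otherwise \<open>rf_minus_id\<close> gives \<open>rf s2 \<le> s2\<close>, and
    \<open>s2\<close> is negative.\<close>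
  have "p2 < s2"
  proof (rule ccontr)
    assume "\<not> p2 < s2"
    then have "(s2 - p1) * (s2 - p2) \<ge> 0"
      using p2_less_p1 by (intro mult_nonpos_nonpos) auto
    then have "c * s2 * ((s2 - p1) * (s2 - p2)) \<le> 0"
      by (rule mult_nonpos_nonneg[OF less_imp_le[OF mult_pos_neg[OF c_pos s2_bounds(2)]]])
    then show False
      using rf_minus_id[of s2] pos s2_bounds by (simp add: mult.assoc)
  qed
  from disconnected_if_left_escapes[OF critical_points(2) this s2_bounds(2) pos] show ?thesis
    using assms(2,3) zero_in_frontier p2_in_frontier by blast
qed

subsection \<open>Connectedness\<close>

text \<open>The hypothesis \<open>b\<close> keeps the image of the segment \<open>{p2..0}\<close>
  below 0, and \<open>p\<close> keeps it above \<open>p2\<close>. The critical value at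
  \<open>s1\<close> serves as test value: \<open>s1\<close> is a double preimage, so only one
  further preimage, a real one, has to be located in the segment.\<close>

lemma connected_frontier:
  assumes b: "b\<^sup>2 \<le> 4 * a * c" and p: "4 * b\<^sup>2 \<ge> (a + 3)\<^sup>2 * c"
  shows "connected (frontier K)"
proof (rule connected_frontier_K)
  have range: "rf x \<in> {p2..0}" if x: "x \<in> {p2..0}" for x
  proof -
    have "4 * c * (a + b * x + c * x\<^sup>2) = (2 * c * x + b)\<^sup>2 + (4 * a * c - b\<^sup>2)"
      by (simp add: algebra_simps power2_eq_square)
    then have "4 * c * (a + b * x + c * x\<^sup>2) \<ge> 0" using b by simp
    then have "a + b * x + c * x\<^sup>2 \<ge> 0" using c_pos by (simp add: zero_le_mult_iff)
    then have "x * (a + b * x + c * x\<^sup>2) \<le> 0" using x by (intro mult_nonpos_nonneg) auto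
    then have "rf x \<le> 0"
      by (simp add: rf_def algebra_simps power2_eq_square power3_eq_cube)
    moreover have "c * x * (x - p1) + 1 = c * (x - p1 / 2)\<^sup>2 + (4 - c * p1\<^sup>2) / 4"
      by (simp add: algebra_simps power2_eq_square field_simps)
    then have "c * x * (x - p1) + 1 \<ge> 0"
      using p1_small[OF p] c_pos by simp
    then have "rf x - p2 \<ge> 0"
      unfolding rf_minus_p2 using x by simp
    ultimately show ?thesis by simp
  qed
  have s1: "s1 \<in> {p2..0}"
    using p2_less_s1 s1_bounds by simp
  show "connected (of_real ` {p2..0} :: complex set)"
    by (intro connected_continuous_image continuous_intros) auto
  show "f ` of_real ` {p2..0} \<subseteq> of_real ` {p2..0}"
    using range by (auto simp: f_of_real)
  show "bounded (of_real ` {p2..0} :: complex set)"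
    by (intro compact_imp_bounded compact_continuous_image continuous_intros) auto
  show "complex_of_real s1 \<in> of_real ` {p2..0}"
    using s1 by blast
  fix w assume w: "f w = f (of_real s1)"
  have a: "of_real a = - 2 * of_real b * of_real s1 - 3 * of_real c * (of_real s1 :: complex)\<^sup>2"
    using arg_cong[OF critical_points(1), of complex_of_real] by (simp add: algebra_simps eq_neg_iff_add_eq_0)
  have "f w - f (of_real s1) = (w - of_real s1)\<^sup>2 * (of_real c * (w + 2 * of_real s1) + of_real b)"
    unfolding f_def unfolding a by (simp add: algebra_simps power2_eq_square power3_eq_cube)
  with w consider "w = of_real s1" | "of_real c * (w + 2 * of_real s1) + of_real b = 0"
    by auto
  then show "w \<in> of_real ` {p2..0}"
  proof cases
    case 2
    \<comment> \<open>The three preimages add up to \<open>- b / c\<close>, and \<open>s1\<close>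
      counts twice.\<close>
    define x where "x = - b / c - 2 * s1"
    have wx: "w = of_real x"
      using 2 c_pos by (simp add: x_def field_simps) (simp add: eq_neg_iff_add_eq_0 algebra_simps)
    have "rf x = rf s1"
      using w by (simp add: wx f_of_real)
    then have "rf x \<ge> p2" using range[OF s1] by simp
    have "x \<ge> p2"
    proof (rule ccontr)
      assume "\<not> x \<ge> p2"
      then have "x < p2" by simp
      then have "(1 + c * p2 * (p2 - p1)) * (p2 - x) > 0"
        using p2_repelling by (intro mult_pos_pos) auto
      with rf_below_p2[OF \<open>x < p2\<close>] \<open>rf x \<ge> p2\<close> show False by simp
    qed
    have "c * x = - b - 2 * (c * s1)"
      using c_pos by (simp add: x_def algebra_simps)
    moreover have "- b < 3 * (c * s1)"
      using s1_bounds(1) c_pos by (simp add: field_simps)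
    ultimately have "c * x < 0"
      using b_pos by linarith
    then have "x \<le> 0" using c_pos by (simp add: mult_less_0_iff)
    with \<open>x \<ge> p2\<close> show ?thesis by (auto simp: wx)
  qed (use s1 in auto)
qed

subsection \<open>Total disconnectedness\<close>

text \<open>Now \<open>rf x = c * x * (x - r)^2\<close>: one critical value is 0 and the other lies
  below \<open>p2\<close>, so the graph crosses the segment three times and points of
  \<open>{p2..0}\<close> have all their preimages there. The backward orbit of \<open>s1\<close> is
  therefore real; it comes close to every frontier point, which makes the frontier real, and it
  escapes, so the frontier contains no interval.\<close>

lemma totally_disconnected_frontier:
  assumes b: "b\<^sup>2 = 4 * a * c" and a9: "a > 9"
  shows "totally_disconnected (frontier K)"
proof -
  define r where "r = - b / (2 * c)"
  have b_r: "b = - 2 * c * r" and r_neg: "r < 0"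
    using b_pos c_pos by (simp_all add: r_def)
  have "4 * a * c = 4 * c\<^sup>2 * r\<^sup>2"
    using b by (simp add: b_r power_mult_distrib)
  then have a_r: "a = c * r\<^sup>2"
    using c_pos by (simp add: power2_eq_square)
  have rf_r: "rf x = c * x * (x - r)\<^sup>2" for x
    unfolding rf_def unfolding a_r b_r by (simp add: algebra_simps power2_eq_square power3_eq_cube)
  have rr: "rf r = 0"
    by (simp add: rf_r)
  have "16 * a < (a + 3)\<^sup>2"
  proof -
    have "(a - 1) * (a - 9) > 0" using a9 by simp
    then show ?thesis by (simp add: algebra_simps power2_eq_square)
  qed
  then have "16 * a * c < (a + 3)\<^sup>2 * c" using c_pos by simp
  then have esc: "rf s1 < p2"
    using a9 b by (intro rf_s1_less_p2 p1_large) auto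
  have s1r: "r < s1"
    using s1_bounds(1) b_pos c_pos by (simp add: r_def field_simps)
  have p2r: "p2 < r"
    using p2_less by (simp add: r_def)
  have cont: "continuous_on {u..v} rf" for u v
    unfolding rf_def by (intro continuous_intros)
  have real_preimage: "w \<in> of_real ` {p2..0}" if y: "y \<in> {p2..0}" and w: "f w = of_real y" for w y
  \<comment> \<open>At 0 the two preimages to the left of \<open>s1\<close> merge in
    \<open>r\<close>, so the count of three distinct preimages fails.\<close>
  proof (cases "y = 0")
    case True
    have "f w = of_real c * w * (w - of_real r)\<^sup>2"
      unfolding f_def unfolding a_r b_r by (simp add: algebra_simps power2_eq_square power3_eq_cube)
    with w True c_pos have "w = of_real 0 \<or> w = of_real r" by auto
    then show ?thesis
      using p2r r_neg p2_neg by (metis atLeastAtMost_iff imageI less_imp_le order_refl)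
  next
    case False
    have "\<exists>x\<ge>p2. x \<le> r \<and> rf x = y"
      by (rule IVT') (use y p2r rf_p2 rr cont in auto)
    then obtain x1 where x1: "p2 \<le> x1" "x1 \<le> r" "rf x1 = y" by blast
    have "\<exists>x\<ge>r. x \<le> s1 \<and> rf x = y"
      by (rule IVT2') (use y s1r esc rr cont in auto)
    then obtain x2 where x2: "r \<le> x2" "x2 \<le> s1" "rf x2 = y" by blast
    have "\<exists>x\<ge>s1. x \<le> 0 \<and> rf x = y"
      by (rule IVT') (use y s1_bounds esc rf_0 cont in auto)
    then obtain x3 where x3: "s1 \<le> x3" "x3 \<le> 0" "rf x3 = y" by blast
    have ne: "x1 \<noteq> r" "x2 \<noteq> r" "x2 \<noteq> s1" "x3 \<noteq> s1"
      using False x1 x2 x3 esc y rr by auto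
    then have less: "x1 < x2" "x2 < x3" using x1 x2 x3 by auto
    \<comment> \<open>The quotient of \<open>f z - f x1\<close> by \<open>z - x1\<close>. It is
      quadratic, so \<open>x2\<close> and \<open>x3\<close> exhaust its roots.\<close>
    define q where "q z = of_real c * z\<^sup>2 + of_real b * z + of_real c * of_real x1 * z
      + of_real a + of_real b * of_real x1 + of_real c * (of_real x1)\<^sup>2" for z :: complex
    have q0: "q z = 0" if "z \<noteq> of_real x1" "f z = of_real y" for z
      using f_diff[of z "of_real x1"] that x1(3) by (simp add: q_def f_of_real)
    have q_diff: "q z - q v = (z - v) * (of_real c * (z + v) + of_real b + of_real c * of_real x1)" for z v
      by (simp add: q_def algebra_simps power2_eq_square)
    have q23: "q (of_real x2) = 0" "q (of_real x3) = 0"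
      using q0[of "of_real x2"] q0[of "of_real x3"] x2(3) x3(3) less by (simp_all add: f_of_real)
    have "w = of_real x1 \<or> w = of_real x2 \<or> w = of_real x3"
    proof (rule ccontr)
      assume n: "\<not> ?thesis"
      then have "q w = 0" using q0 w by blast
      with q23 q_diff[of w "of_real x2"] q_diff[of "of_real x3" "of_real x2"] n less
      have "of_real c * (w + of_real x2) = of_real c * (of_real x3 + of_real x2 :: complex)"
        by (auto simp: add_eq_0_iff)
      then show False using n c_pos by simp
    qed
    then show ?thesis
      using x1 x2 x3 less p2_neg r_neg s1_bounds by auto
  qed
  have s1: "s1 \<in> {p2..0}"
    using p2_less_s1 s1_bounds by simp
  have iterated: "w \<in> of_real ` {p2..0}" if "(f ^^ n) w = of_real s1" for n w
    using that
  proof (induction n arbitrary: w)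
    case (Suc n)
    then have "f w \<in> of_real ` {p2..0}"
      by (simp add: funpow_swap1)
    then show ?case using real_preimage by auto
  qed (use s1 in auto)
  have near: "\<exists>x n. x \<in> {p2..0} \<and> (f ^^ n) (of_real x) = of_real s1 \<and> dist (of_real x) z < e"
    if "z \<in> frontier K" "e > 0" for z e
  proof -
    obtain u v where "f u = of_real s1" "f v = of_real s1" "u \<noteq> v"
      using two_preimages by blast
    from frontier_K_preimages[OF that this] obtain n w where "dist w z < e" "(f ^^ n) w = of_real s1"
      by (auto simp: eventually_sequentially)
    then show ?thesis using iterated by blast
  qed
  have real: "frontier K \<subseteq> of_real ` {p2..0}"
  proof -
    have "closed (of_real ` {p2..0} :: complex set)"
      by (intro compact_imp_closed compact_continuous_image continuous_intros) auto
    moreover have "z \<in> closure (of_real ` {p2..0})" if z: "z \<in> frontier K" for z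
      unfolding closure_approachable using near[OF z] by (metis imageI)
    ultimately show ?thesis by auto
  qed
  have "\<exists>x. C = {x}" if C: "C \<in> components (frontier K)" for C
  proof -
    have sub: "C \<subseteq> frontier K" and conn: "connected C" and ne: "C \<noteq> {}"
      using C in_components_subset in_components_connected in_components_nonempty by blast+
    have False if xy: "of_real x \<in> C" "of_real y \<in> C" "x < y" for x y
    proof -
      have "connected (Re ` C)"
        using conn by (intro connected_continuous_image continuous_intros)
      then have "{x..y} \<subseteq> Re ` C"
        using xy by (intro connected_contains_Icc) force+
      moreover have "z = of_real (Re z)" if "z \<in> C" for z
        using that sub real by auto
      ultimately have seg: "of_real t \<in> C" if "t \<in> {x..y}" for t
        using that by (metis image_iff subsetD)
      define m where "m = (x + y) / 2"
      have "of_real m \<in> frontier K"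
        using seg[of m] xy(3) sub by (auto simp: m_def)
      then obtain t n where t: "(f ^^ n) (of_real t) = of_real s1" "dist (of_real t) (of_real m :: complex) < (y - x) / 2"
        using near[of "of_real m" "(y - x) / 2"] xy(3) by auto
      then have "\<bar>t - m\<bar> < (y - x) / 2"
        by (simp only: dist_of_real dist_real_def)
      then have "t \<in> {x..y}"
        by (auto simp: m_def abs_if field_simps split: if_splits)
      then have "of_real t \<in> K"
        using seg sub frontier_K_subset by blast
      then have "of_real s1 \<in> K"
        using t(1) K_iterate_iff by metis
      then have "of_real (rf s1) \<in> K"
        using K_image_iff[of "of_real s1"] by (simp add: f_of_real)
      then show False using escape_left[OF esc] by blast
    qed
    then have "x = y" if "of_real x \<in> C" "of_real y \<in> C" for x y
      using that by (metis linorder_neqE_linordered_idom)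
    moreover obtain z where "z \<in> C" using ne by auto
    moreover have "C \<subseteq> of_real ` {p2..0}"
      using sub real by blast
    ultimately have "C = {z}" by blast
    then show ?thesis ..
  qed
  then show ?thesis
    by (simp add: totally_disconnected_def)
qed

subsection \<open>Attracting and parabolic fixed points\<close>

text \<open>The remainder of the second iterate of \<open>u \<mapsto> -u + \<beta> u\<^sup>2 + \<gamma> u\<^sup>3\<close> after the cubic term, divided
  by \<open>u\<^sup>4\<close>.\<close>

definition F2_rest :: "real \<Rightarrow> real \<Rightarrow> complex \<Rightarrow> complex" where
  "F2_rest \<beta> \<gamma> u = of_real (\<beta> * (\<beta>\<^sup>2 - 2 * \<gamma>) + 3 * \<beta> * \<gamma>)
     + of_real (2 * \<beta>\<^sup>2 * \<gamma> - \<gamma> * (3 * \<beta>\<^sup>2 - 3 * \<gamma>)) * u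
     + of_real (\<beta> * \<gamma>\<^sup>2 - \<gamma> * (6 * \<beta> * \<gamma> - \<beta> ^ 3)) * u\<^sup>2
     - of_real (\<gamma> * (3 * \<gamma>\<^sup>2 - 3 * \<beta>\<^sup>2 * \<gamma>)) * u ^ 3
     + of_real (3 * \<beta> * \<gamma> ^ 3) * u ^ 4 + of_real (\<gamma> ^ 4) * u ^ 5"

text \<open>With multiplier -1 the quadratic terms cancel in the second iterate. Here
  \<open>\<beta>\<close> is half the second derivative at \<open>y\<close>, and the cubic
  coefficient does not vanish because \<open>c > 0\<close>.\<close>

lemma second_iterate_expansion:
  assumes y: "rf y = y" "a + 2 * b * y + 3 * c * y\<^sup>2 = - 1"
  defines "\<beta> \<equiv> b + 3 * c * y"
  shows "f (f (of_real y + u)) = of_real y + u - of_real (2 * (\<beta>\<^sup>2 + c)) * u ^ 3 + u ^ 4 * F2_rest \<beta> c u"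
proof -
  have a: "a = - 1 - 2 * b * y - 3 * c * y\<^sup>2"
    using y(2) by simp
  have step: "f (of_real y + v) = of_real y + (- v + of_real \<beta> * v\<^sup>2 + of_real c * v ^ 3)" for v
  proof -
    have "f (of_real y + v) = f (of_real y) + (of_real a + 2 * of_real b * of_real y + 3 * of_real c * (of_real y)\<^sup>2) * v
        + of_real \<beta> * v\<^sup>2 + of_real c * v ^ 3"
      by (simp add: f_def \<beta>_def algebra_simps power2_eq_square power3_eq_cube)
    also have "of_real a + 2 * of_real b * of_real y + 3 * of_real c * (of_real y)\<^sup>2 = (- 1 :: complex)"
      using arg_cong[OF y(2), of complex_of_real] by simp
    finally show ?thesis
      by (simp add: f_of_real y(1))
  qed
  show ?thesis
    unfolding step F2_rest_def
    by (simp add: algebra_simps power2_eq_square power3_eq_cube eval_nat_numeral)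
qed

lemma holomorphic_F2_rest: "F2_rest \<beta> \<gamma> holomorphic_on A"
  unfolding F2_rest_def by (intro holomorphic_intros)

lemma multiplier_minus_one_not_interior:
  assumes "rf y = y" "a + 2 * b * y + 3 * c * y\<^sup>2 = - 1"
  shows "of_real y \<notin> interior K"
proof (rule parabolic_not_in_interior_K[OF second_iterate_expansion[OF assms] holomorphic_F2_rest])
  have "2 * ((b + 3 * c * y)\<^sup>2 + c) > 0"
    using c_pos by (simp add: add_nonneg_pos)
  then show "complex_of_real (2 * ((b + 3 * c * y)\<^sup>2 + c)) \<noteq> 0"
    by (simp only: of_real_eq_0_iff)
qed

text \<open>The last two factors on the left are 1 plus the multipliers of \<open>p1\<close> and
  \<open>p2\<close>. The one for \<open>p2\<close> is positive, so the right-hand side has the sign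
  of 1 plus the multiplier of \<open>p1\<close>.\<close>

lemma fixpoint_multiplier_identity:
  "c * (2 + c * p1 * (p1 - p2)) * (2 + c * p2 * (p2 - p1)) = 4 * c * (a - 2)\<^sup>2 - (a - 3) * b\<^sup>2"
proof -
  obtain u v where uv: "p1 = u" "p2 = v" "b = - c * (u + v)" "a = 1 + c * u * v"
    by (rule vieta)
  show ?thesis
    unfolding uv(1,2) unfolding uv(3,4)
    by (simp add: algebra_simps power2_eq_square power3_eq_cube)
qed

text \<open>The hypothesis places the multiplier of \<open>p1\<close> in the interval from -1 to 1,
  with 1 excluded: above -1 the point attracts a disc, at -1 it has a petal.\<close>

lemma interior_K_nonempty:
  assumes "(a - 3) * b\<^sup>2 \<le> 4 * c * (a - 2)\<^sup>2"
  shows "interior K \<noteq> {}"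
proof -
  define m where "m = 1 + c * p1 * (p1 - p2)"
  have m_lt: "m < 1"
    using c_pos p1_neg p2_less_p1 by (simp add: m_def mult_neg_pos mult_pos_neg)
  have "(c * (2 + c * p2 * (p2 - p1))) * (1 + m) \<ge> 0"
    using assms fixpoint_multiplier_identity by (simp add: m_def algebra_simps)
  moreover have "c * (2 + c * p2 * (p2 - p1)) > 0"
    using c_pos p2_repelling by simp
  ultimately have "m \<ge> - 1"
    by (simp add: zero_le_mult_iff)
  show ?thesis
  proof (cases "m = - 1")
    case True
    then have "a + 2 * b * p1 + 3 * c * p1\<^sup>2 = - 1"
      using multiplier_p1 by (simp add: m_def)
    from parabolic_petal[OF second_iterate_expansion[OF rf_p1 this] holomorphic_F2_rest] show ?thesis
      using c_pos by (simp add: add_nonneg_pos)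
  next
    case False
    have "(f has_field_derivative of_real m) (at (of_real p1))"
      using deriv_f[of "of_real p1"] multiplier_p1 unfolding m_def
      by (metis (no_types, lifting) of_real_add of_real_mult of_real_numeral of_real_power)
    then have "of_real p1 \<in> interior K"
      by (rule attracting_in_interior_K[rotated])
         (use m_lt \<open>m \<ge> - 1\<close> False in \<open>auto simp: f_of_real rf_p1\<close>)
    then show ?thesis by auto
  qed
qed

subsection \<open>The Hausdorff limit of the preimages of -1\<close>

definition X :: "nat \<Rightarrow> complex set" where
  "X m = {z. (f ^^ m) z = - 1}"

lemma X_nonempty: "X m \<noteq> {}"
proof -
  have "\<exists>z. (f ^^ m) z = y" for y
  proof (induction m arbitrary: y)
    case (Suc m)
    obtain w where w: "f w = y" using ex_preimage by blast
    obtain z where "(f ^^ m) z = w" using Suc by blast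
    with w show ?case by (intro exI[of _ z]) simp
  qed auto
  then show ?thesis by (auto simp: X_def)
qed

lemma X_subset: "X m \<subseteq> cball 0 R"
proof
  fix z assume "z \<in> X m"
  then have "norm ((f ^^ m) z) \<le> R"
    using R_gt by (simp add: X_def)
  then show "z \<in> cball 0 R"
    using iterate_escapes[of z m] by force
qed

lemma compact_X: "compact (X m)"
proof -
  have "closed (X m)"
    unfolding X_def by (intro closed_Collect_eq continuous_iterate continuous_intros)
  then show ?thesis
    using bounded_subset[OF bounded_cball X_subset] by (simp add: compact_eq_bounded_closed)
qed

lemma frontier_X:
  assumes "z \<in> frontier K" "e > 0"
  shows "\<forall>\<^sub>F m in sequentially. \<exists>x\<in>X m. dist x z < e"
proof -
  obtain u v where "f u = - 1" "f v = - 1" "u \<noteq> v"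
    using two_preimages by blast
  from frontier_K_preimages[OF assms this] show ?thesis
    by (rule eventually_mono) (auto simp: X_def)
qed

text \<open>An attracting cycle through \<open>-1\<close> consists of integers, each dividing the next one, so it is
  a fixed point; its multiplier is an integer in the closed unit disc.\<close>

lemma recurrent_interior:
  assumes int: "a = of_int A" "b = of_int B" "c = of_int C"
    and inter: "- 1 \<in> interior K" and rec: "\<And>e. e > 0 \<Longrightarrow> \<exists>n>0. dist ((f ^^ n) (- 1)) (- 1) < e"
  shows "a = c + 2 \<and> b = 2 * c + 1"
proof -
  define F where "F x = A * x + B * x\<^sup>2 + C * x ^ 3" for x :: int
  have fF: "f (of_int x) = of_int (F x)" for x
    unfolding f_def F_def unfolding int by simp
  have iter: "(f ^^ n) (of_int x) = of_int ((F ^^ n) x)" for n x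
    by (induction n) (simp_all add: fF)
  have dvd: "x dvd (F ^^ n) x" for n x
  proof (induction n)
    case (Suc n)
    have "(F ^^ n) x dvd F ((F ^^ n) x)"
      unfolding F_def by (intro dvd_add dvd_mult) (simp_all add: dvd_power)
    with Suc show ?case by (simp add: dvd_trans)
  qed simp
  obtain n where n: "n > 0" "dist ((f ^^ n) (- 1)) (- 1) < 1"
    using rec[of 1] by auto
  have "(f ^^ n) (- 1) = of_int ((F ^^ n) (- 1))"
    using iter[of n "- 1"] by simp
  with n(2) have "dist (of_int ((F ^^ n) (- 1)) :: complex) (of_int (- 1)) < 1"
    by simp
  then have "(F ^^ n) (- 1) = - 1"
    by (simp only: dist_of_int)
  moreover have "(F ^^ n) (- 1) = (F ^^ (n - 1)) (F (- 1))"
    using n(1) by (cases n) (simp_all add: funpow_swap1)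
  ultimately have "F (- 1) dvd - 1"
    using dvd[of "F (- 1)" "n - 1"] by simp
  then have "F (- 1) = 1 \<or> F (- 1) = - 1"
    by (simp add: zdvd1_eq) linarith
  moreover have "F (- 1) \<noteq> 1"
  proof
    assume "F (- 1) = 1"
    then have "f (- 1) = of_real 1"
      using fF[of "- 1"] by simp
    moreover have "f (- 1) \<in> K"
      using inter interior_subset K_image_iff by blast
    ultimately show False
      using escape_right[of 1] by simp
  qed
  ultimately have F1: "F (- 1) = - 1" by simp
  have f1: "f (- 1) = - 1"
    using fF[of "- 1"] F1 by simp
  have "real_of_int (F (- 1)) = - a + b - c"
    unfolding F_def int by simp
  then have bac: "b = a + c - 1"
    using F1 by simp
  have "deriv f (- 1) = of_int (A - 2 * B + 3 * C)"
    unfolding DERIV_imp_deriv[OF deriv_f[of "- 1"]] unfolding int by simp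
  then have "\<bar>A - 2 * B + 3 * C\<bar> \<le> 1"
    using interior_K_multiplier[OF inter f1] by (simp only: norm_of_int)
  then have "A - 2 * B + 3 * C \<in> {- 1, 0, 1}" by auto
  moreover have "a - 2 * b + 3 * c = real_of_int (A - 2 * B + 3 * C)"
    unfolding int by simp
  \<comment> \<open>These are the possible multipliers of -1. The value -1 is excluded because a
    parabolic point is not interior, the value 1 because it gives
    \<open>b^2 = 4 * c * (a - 1)\<close>; 0 is the exceptional polynomial.\<close>
  ultimately consider "a - 2 * b + 3 * c = - 1" | "a - 2 * b + 3 * c = 0" | "a - 2 * b + 3 * c = 1"
    by fastforce
  then show ?thesis
  proof cases
    case 1
    have "rf (- 1) = - a + b - c"
      by (simp add: rf_def)
    then have "rf (- 1) = - 1"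
      using bac by linarith
    from multiplier_minus_one_not_interior[OF this] show ?thesis
      using 1 inter by simp
  next
    case 3
    then have ac: "a - 1 = c" and bc: "b = 2 * c"
      using bac by auto
    have "b\<^sup>2 = 4 * c * (a - 1)"
      unfolding ac bc by (simp add: power2_eq_square)
    then show ?thesis
      using fixpts by simp
  qed (use bac in auto)
qed

lemma hausdorff_limit_frontier:
  assumes int: "a = of_int A" "b = of_int B" "c = of_int C"
    and ne: "\<not> (a = c + 2 \<and> b = 2 * c + 1)"
  shows "hausdorff_limit X (frontier K)"
proof (rule hausdorff_limitI[OF X_nonempty X_subset compact_cball])
  show "frontier K \<noteq> {}" using zero_in_frontier by auto
  show "frontier K \<subseteq> cball 0 R"
    using frontier_K_subset K_subset_cball by blast
  fix s :: "nat \<Rightarrow> nat" and x z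
  assume s: "strict_mono s" and x: "\<And>k. x k \<in> X (s k)" "x \<longlonglongrightarrow> z"
  have eq: "(f ^^ s k) (x k) = - 1" for k
    using x(1) by (simp add: X_def)
  have "z \<in> K"
    using R_gt by (intro limit_of_preimages_in_K[OF s eq x(2)]) auto
  moreover have "z \<notin> interior K"
    using limit_of_preimages_interior_K[OF s eq x(2)] recurrent_interior[OF int] ne by blast
  ultimately show "z \<in> frontier K"
    using closed_K by (simp add: frontier_def)
qed (use frontier_X in auto)

text \<open>In the exceptional case \<open>f z + 1 = (1 + z)\<^sup>2 (1 + c z)\<close>, so \<open>-1\<close> is a superattracting fixed point.\<close>

lemma exceptional_case:
  assumes abc: "a = c + 2" "b = 2 * c + 1" and c: "c \<ge> 2"
  obtains A where "hausdorff_limit X A" "frontier K \<subseteq> A" "\<not> connected A"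
proof
  have fz: "f z + 1 = (1 + z)\<^sup>2 * (1 + of_real c * z)" for z
    unfolding f_def unfolding abc by (simp add: algebra_simps power2_eq_square power3_eq_cube)
  have f1: "f (- 1) = - 1"
    using fz[of "- 1"] by (simp add: eq_neg_iff_add_eq_0)
  have iter1: "(f ^^ n) (- 1) = - 1" for n
    by (induction n) (simp_all add: f1)
  have X_mono: "X m \<subseteq> X n" if "m \<le> n" for m n
  proof
    fix z assume "z \<in> X m"
    then show "z \<in> X n"
      using that iter1[of "n - m"] funpow_add[of "n - m" m f] by (simp add: X_def)
  qed
  \<comment> \<open>As -1 is fixed, the sets \<open>X m\<close> increase, so their limit is the
    closure of their union.\<close>
  define A where "A = closure (\<Union>m. X m)"
  show sub: "frontier K \<subseteq> A"
  proof
    fix z assume z: "z \<in> frontier K"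
    show "z \<in> A"
      unfolding A_def closure_approachable
    proof (intro allI impI)
      fix e :: real assume "e > 0"
      from frontier_X[OF z this] obtain m where "\<exists>x\<in>X m. dist x z < e"
        using eventually_happens trivial_limit_sequentially by blast
      then show "\<exists>y\<in>\<Union> (range X). dist y z < e" by auto
    qed
  qed
  show "hausdorff_limit X A"
  proof (rule hausdorff_limitI[OF X_nonempty X_subset compact_cball])
    show "A \<noteq> {}" using sub zero_in_frontier by auto
    show "closed A" by (simp add: A_def)
    show "A \<subseteq> cball 0 R"
      unfolding A_def by (intro closure_minimal) (use X_subset in auto)
  next
    fix z and e :: real assume "z \<in> A" "e > 0"
    then obtain m x where "x \<in> X m" "dist x z < e"
      unfolding A_def closure_approachable by auto
    then have "\<exists>x\<in>X n. dist x z < e" if "m \<le> n" for n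
      using X_mono[OF that] by blast
    then show "\<forall>\<^sub>F m in sequentially. \<exists>x\<in>X m. dist x z < e"
      unfolding eventually_sequentially by blast
  next
    fix s :: "nat \<Rightarrow> nat" and x z
    assume "\<And>k. x k \<in> X (s k)" "x \<longlonglongrightarrow> z"
    then show "z \<in> A"
      unfolding A_def closure_sequential by blast
  qed
  \<comment> \<open>On this disc \<open>1 + c * z\<close> differs from \<open>1 - c\<close> by less
    than \<open>1 / 2\<close>. As \<open>c \<ge> 2\<close>, it is nonzero and at most
    \<open>c\<close> in modulus; hence \<open>U\<close> is mapped into itself and contains no
    preimage of -1 except -1.\<close>
  define U where "U = ball (- 1 :: complex) (1 / (2 * c))"
  have U: "f z \<in> U" "f z = - 1 \<Longrightarrow> z = - 1" if z: "z \<in> U" for z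
  proof -
    have zn: "norm (1 + z) < 1 / (2 * c)"
      using z by (simp add: U_def dist_norm norm_minus_commute[of "- 1"] add.commute)
    then have cz: "c * norm (1 + z) < 1 / 2"
      using c by (simp add: field_simps)
    have eq: "1 + of_real c * z = of_real c * (1 + z) - of_real (c - 1)"
      by (simp add: algebra_simps)
    have "norm (1 + of_real c * z) \<le> norm (of_real c * (1 + z)) + norm (of_real (c - 1) :: complex)"
      unfolding eq by (rule norm_triangle_ineq4)
    also have "\<dots> \<le> 1 / 2 + (c - 1)"
      using cz c by (simp add: norm_mult del: of_real_diff)
    finally have "norm (1 + of_real c * z) \<le> c"
      by simp
    then have "norm (1 + z) * norm (1 + of_real c * z) \<le> 1 / (2 * c) * c"
      using zn c by (intro mult_mono) auto
    then have "norm (1 + z) * norm (1 + of_real c * z) \<le> 1"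
      using c by simp
    then have "norm (1 + z) * (norm (1 + z) * norm (1 + of_real c * z)) \<le> norm (1 + z) * 1"
      by (intro mult_left_mono) auto
    then have "norm (f z + 1) < 1 / (2 * c)"
      using zn by (simp add: fz norm_mult power2_eq_square mult.assoc)
    then show "f z \<in> U"
      by (simp add: U_def dist_norm norm_minus_commute[of "- 1"])
    assume "f z = - 1"
    then have "z = - 1 \<or> 1 + of_real c * z = 0"
      using fz[of z] by (simp add: add_eq_0_iff)
    moreover have "1 + of_real c * z \<noteq> 0"
    proof
      assume "1 + of_real c * z = 0"
      then have "norm (of_real c * (1 + z)) = norm (of_real (c - 1) :: complex)"
        using eq by simp
      then show False
        using cz c by (simp add: norm_mult del: of_real_diff)
    qed
    ultimately show "z = - 1" by simp
  qed
  have XU: "z = - 1" if "z \<in> X m" "z \<in> U" for z m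
    using that
  proof (induction m arbitrary: z)
    case (Suc m)
    then have "f z \<in> X m" by (simp add: X_def funpow_swap1)
    with Suc U(1)[of z] have "f z = - 1" by blast
    then show ?case using U(2) Suc by blast
  qed (simp add: X_def)
  have "open U" by (simp add: U_def)
  have AU: "U \<inter> A \<subseteq> {- 1}"
  proof -
    have "U \<inter> A \<subseteq> closure (U \<inter> (\<Union>m. X m))"
      unfolding A_def using \<open>open U\<close> by (rule open_Int_closure_subset)
    also have "\<dots> \<subseteq> closure {- 1}"
      using XU by (intro closure_mono) blast
    finally show ?thesis by simp
  qed
  show "\<not> connected A"
  proof
    assume conn: "connected A"
    have m1: "- 1 \<in> U" using c by (simp add: U_def)
    have "open (- {- 1 :: complex})" by auto
    moreover have "U \<inter> - {- 1} \<inter> A = {}" using AU by blast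
    moreover have "A \<subseteq> U \<union> - {- 1}" using m1 by blast
    ultimately have "U \<inter> A = {} \<or> - {- 1} \<inter> A = {}"
      using connectedD[OF conn \<open>open U\<close>, of "- {- 1}"] by blast
    moreover have "- 1 \<in> A"
    proof -
      have "- 1 \<in> X 0" by (simp add: X_def)
      then show ?thesis
        unfolding A_def using closure_subset[of "\<Union> (range X)"] by auto
    qed
    moreover have "0 \<in> A" using sub zero_in_frontier by blast
    moreover have "0 \<noteq> (- 1 :: complex)" by simp
    ultimately show False using m1 by blast
  qed
qed

end

section \<open>Small independence polynomials\<close>

lemma independence_3_vertices:
  assumes "finite (pverts G)" "independence_number G = 3"
  shows "num_independent G 3 \<ge> 1" "card (pverts G) \<ge> 3"
proof -
  show n3: "num_independent G 3 \<ge> 1"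
    using num_independent_independence_number_pos[OF assms(1)] assms(2) by simp
  then obtain S where "independent_set G S" "card S = 3"
    unfolding num_independent_def by (metis (mono_tags, lifting) Collect_empty_eq card.empty not_one_le_zero)
  then show "card (pverts G) \<ge> 3"
    using card_mono[OF assms(1), of S] by (simp add: independent_set_def)
qed

text \<open>The second alternative is the exceptional polynomial \<open>(1 + z)\<^sup>2 (1 + t z)\<close>; in the third one a fixed
  point has multiplier \<open>-1\<close>.\<close>

lemma small_cases:
  fixes n e t :: nat
  assumes n: "4 \<le> n" "n \<le> 8" and lower: "4 * n * t < e\<^sup>2 + 4 * t" and upper: "e\<^sup>2 < 4 * n * t"
    and mm: "4 * e\<^sup>2 \<le> 3 * n * t + n\<^sup>2 * e"
  shows "n \<ge> 6 \<and> 4 * e\<^sup>2 < (n + 3)\<^sup>2 * t \<or> n = t + 2 \<and> e = 2 * t + 1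
    \<or> n \<le> 7 \<and> (n - 3) * e\<^sup>2 = 4 * (n - 2)\<^sup>2 * t \<or> (n, e, t) \<in> {(7, 9, 3), (8, 11, 4)}"
proof -
  have n': "n \<in> {4, 5, 6, 7, 8}" using n by auto
  \<comment> \<open>By \<open>lower\<close>, \<open>t\<close> is less than
    \<open>e^2 / (4 * (n - 1))\<close>; inserted in \<open>mm\<close> this bounds \<open>e\<close>
    in terms of \<open>n\<close>, with the largest bound, below 21, at \<open>n = 8\<close>. For
    fixed \<open>n\<close> and \<open>e\<close> only linear conditions on \<open>t\<close>
    remain.\<close>
  have "e \<le> 20"
  proof (rule ccontr)
    assume "\<not> e \<le> 20"
    then have "21 * e \<le> e\<^sup>2"
      unfolding power2_eq_square by (intro mult_right_mono) auto
    then show False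
      using n' lower mm \<open>\<not> e \<le> 20\<close> by auto
  qed
  then have "e = 0 \<or> e = 1 \<or> e = 2 \<or> e = 3 \<or> e = 4 \<or> e = 5 \<or> e = 6 \<or> e = 7 \<or> e = 8 \<or> e = 9 \<or> e = 10
    \<or> e = 11 \<or> e = 12 \<or> e = 13 \<or> e = 14 \<or> e = 15 \<or> e = 16 \<or> e = 17 \<or> e = 18 \<or> e = 19 \<or> e = 20"
    by presburger
  moreover have "n = 4 \<or> n = 5 \<or> n = 6 \<or> n = 7 \<or> n = 8"
    using n' by simp
  moreover have "t = 0 \<or> t = 1 \<or> t = 2 \<or> t = 3 \<or> t = 4 \<or> t = 5 \<or> t = 6 \<or> t = 7 \<or> t = 8 \<or> t = 9 \<or> t = 10
    \<or> t = 11 \<or> t = 12 \<or> t \<ge> 13"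
    by presburger
  ultimately show ?thesis
    using lower upper mm by (elim disjE) simp_all
qed

theorem theorem1p4:
  fixes G :: "'a pair_pre_digraph" and a1 a2 a3 :: nat
  assumes "pair_graph G"
    and "independence_number G = 3"
    and "independence_poly G = [:1, of_nat a1, of_nat a2, of_nat a3:]"
    and "(real a2)\<^sup>2 > 3 * real a1 * real a3"
    and "(real a2)\<^sup>2 > 4 * real a3 * (real a1 - 1)"
  shows
    "((real a2)\<^sup>2 < 4 * real a1 * real a3 \<longrightarrow>
       (4 * real a3 * (real a1 - 1) < (real a2)\<^sup>2 \<and>
        (real a2)\<^sup>2 < real a3 * (2 * real a1 - 3)\<^sup>2 / (real a1 - 2) \<longrightarrow>
          \<not> connected (independence_attractor G) \<and>
          \<not> totally_disconnected (independence_attractor G)) \<and>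
       ((real a2)\<^sup>2 = real a3 * (2 * real a1 - 3)\<^sup>2 / (real a1 - 2) \<longrightarrow>
          \<not> connected (independence_attractor G) \<and>
          \<not> totally_disconnected (independence_attractor G)) \<and>
       (real a3 * (2 * real a1 - 3)\<^sup>2 / (real a1 - 2) < (real a2)\<^sup>2 \<and>
        (real a2)\<^sup>2 < 4 * real a3 * (real a1 - 2)\<^sup>2 / (real a1 - 3) \<longrightarrow>
          \<not> connected (independence_attractor G) \<and>
          \<not> totally_disconnected (independence_attractor G)) \<and>
       ((real a2)\<^sup>2 = 4 * real a3 * (real a1 - 2)\<^sup>2 / (real a1 - 3) \<longrightarrow>
          (a1 \<le> 7 \<longrightarrow> connected (independence_attractor G)) \<and>
          (a1 > 7 \<longrightarrow> \<not> connected (independence_attractor G) \<and>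
                     \<not> totally_disconnected (independence_attractor G))) \<and>
       (4 * real a3 * (real a1 - 2)\<^sup>2 / (real a1 - 3) < (real a2)\<^sup>2 \<and>
        (real a2)\<^sup>2 < 4 * real a1 * real a3 \<and>
        (a1, a2, a3) \<notin> {(7, 9, 3), (8, 11, 4)} \<longrightarrow>
          \<not> connected (independence_attractor G))) \<and>
     ((real a2)\<^sup>2 = 4 * real a1 * real a3 \<longrightarrow>
       (a1 \<le> 9 \<longrightarrow> connected (independence_attractor G)) \<and>
       (a1 > 9 \<longrightarrow> totally_disconnected (independence_attractor G))) \<and>
     ((real a2)\<^sup>2 > 4 * real a1 * real a3 \<longrightarrow>
       \<not> connected (independence_attractor G))"
proof -
  interpret pair_graph G by fact
  note fin = pair_finite_verts
  define a b c where "a = real a1" and "b = real a2" and "c = real a3"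
  note abc = a_def b_def c_def
  have num: "num_independent G 1 = a1" "num_independent G 2 = a2" "num_independent G 3 = a3"
    using coeff_independence_poly[OF fin, of 1] coeff_independence_poly[OF fin, of 2]
      coeff_independence_poly[OF fin, of 3] assms(3) by (simp_all add: numeral_2_eq_2 numeral_3_eq_3)
  have "pair_loopfree_digraph G" by unfold_locales
  then have a1_eq: "card (pverts G) = a1"
    using num_independent_1[of G] num(1) by simp
  have a3_ge: "a3 \<ge> 1" and "a1 \<ge> 3"
    using independence_3_vertices[OF fin assms(2)] num(3) a1_eq by auto
  have mm: "4 * a2\<^sup>2 \<le> 3 * a1 * a3 + a1\<^sup>2 * a2"
    using num_independent_moon_moser[OF assms(1)] unfolding num .
  have crit: "b\<^sup>2 > 3 * a * c" and fixpts: "b\<^sup>2 > 4 * c * (a - 1)"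
    using assms(4,5) by (simp_all add: abc)
  \<comment> \<open>This makes the denominators \<open>a1 - 2\<close> and \<open>a1 - 3\<close> of
    the thresholds positive.\<close>
  have a1_ge: "a1 \<ge> 4"
  proof (rule ccontr)
    assume "\<not> a1 \<ge> 4"
    with \<open>a1 \<ge> 3\<close> have a1: "a1 = 3" by simp
    have "real (9 * a3) < real (a2\<^sup>2)"
      using assms(4) by (simp add: a1)
    then have 1: "9 * a3 < a2\<^sup>2" by (simp only: of_nat_less_iff)
    then have "3 * a2\<^sup>2 < 9 * a2" using mm by (simp add: a1)
    then have "a2 < 3" by (simp add: power2_eq_square)
    then have "a2\<^sup>2 \<le> 2\<^sup>2" by (intro power_mono) auto
    with 1 a3_ge show False by simp
  qed
  then have a4: "a \<ge> 4" and c1: "c \<ge> 1"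
    using a3_ge by (simp_all add: abc)
  have b_pos: "b > 0"
  proof -
    have "3 * a * c > 0" using a4 c1 by simp
    with crit have "b \<noteq> 0" by auto
    then show ?thesis by (simp add: b_def)
  qed
  interpret cubic_map a b c
  proof
    show "a > 1" "c > 0" using a4 c1 by simp_all
  qed (fact b_pos crit fixpts)+
  define Sp where "Sp \<longleftrightarrow> a = c + 2 \<and> b = 2 * c + 1"
  have X_eq: "(\<lambda>m. roots (independence_poly (lex_power G m))) = X"
  proof
    fix m
    have "(\<lambda>w. poly (independence_poly G) w - 1) = f"
      unfolding f_def unfolding abc
      by (rule ext) (simp add: assms(3) algebra_simps power2_eq_square power3_eq_cube)
    then show "roots (independence_poly (lex_power G m)) = X m"
      by (auto simp: roots_def X_def poly_independence_poly_lex_power[OF fin] eq_neg_iff_add_eq_0)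
  qed
  have attractor: "independence_attractor G = A" if "hausdorff_limit X A" for A
    unfolding independence_attractor_def X_eq
    by (rule the_equality) (fact that, rule hausdorff_limit_unique[OF compact_X X_nonempty _ that])
  obtain A where A: "independence_attractor G = A" "frontier K \<subseteq> A"
    "Sp \<and> \<not> connected A \<or> \<not> Sp \<and> A = frontier K"
  proof (cases Sp)
    case True
    then have ac: "a = c + 2" "b = 2 * c + 1" by (auto simp: Sp_def)
    \<comment> \<open>For \<open>c = 1\<close> the exceptional coefficients are
      \<open>a = b = 3\<close>, and \<open>crit\<close> would read 9 > 9.\<close>
    have "c \<noteq> 1" using crit unfolding ac by auto
    then have "c \<ge> 2" using c1 by (simp add: c_def)
    from exceptional_case[OF ac this] show ?thesis
      using attractor that True by metis
  next
    case False
    have "hausdorff_limit X (frontier K)"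
      by (rule hausdorff_limit_frontier[of "int a1" "int a2" "int a3"]) (use False in \<open>simp_all add: abc Sp_def\<close>)
    with attractor that False show ?thesis by blast
  qed
  have disc: "\<not> connected A" if "Sp \<or> a \<ge> 5 \<and> 4 * b\<^sup>2 < (a + 3)\<^sup>2 * c \<or> b\<^sup>2 > 4 * a * c"
    using that A(3) not_connected_of_escaping[of A] frontier_K_subset by blast
  have ntd: "\<not> totally_disconnected A" if "(a - 3) * b\<^sup>2 \<le> 4 * c * (a - 2)\<^sup>2"
    using not_totally_disconnected_supset[OF interior_K_nonempty[OF that] A(2)] .
  \<comment> \<open>For \<open>a1 \<ge> 9\<close> the sign of \<open>(a - 1) * (a - 9)\<close>
    places \<open>4 * a * c\<close>, and with it \<open>b^2\<close>, on the escaping side; the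
    smaller values are the finite check in \<open>small_cases\<close>.\<close>
  have main: "Sp \<or> a \<ge> 5 \<and> 4 * b\<^sup>2 < (a + 3)\<^sup>2 * c \<or> a1 \<le> 7 \<and> (a - 3) * b\<^sup>2 = 4 * c * (a - 2)\<^sup>2
      \<or> (a1, a2, a3) \<in> {(7, 9, 3), (8, 11, 4)}" if lt: "b\<^sup>2 < 4 * a * c"
  proof (cases "a1 \<le> 8")
    case True
    have "real (4 * a1 * a3) < real (a2\<^sup>2 + 4 * a3)"
      using fixpts by (simp add: abc algebra_simps)
    then have 1: "4 * a1 * a3 < a2\<^sup>2 + 4 * a3" by (simp only: of_nat_less_iff)
    have "real (a2\<^sup>2) < real (4 * a1 * a3)"
      using lt by (simp add: abc)
    then have 2: "a2\<^sup>2 < 4 * a1 * a3" by (simp only: of_nat_less_iff)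
    from small_cases[OF a1_ge True 1 2 mm]
    consider "a1 \<ge> 6" "4 * a2\<^sup>2 < (a1 + 3)\<^sup>2 * a3" | "a1 = a3 + 2" "a2 = 2 * a3 + 1"
      | "a1 \<le> 7" "(a1 - 3) * a2\<^sup>2 = 4 * (a1 - 2)\<^sup>2 * a3" | "(a1, a2, a3) \<in> {(7, 9, 3), (8, 11, 4)}"
      by blast
    then show ?thesis
    proof cases
      case 1
      then have "real (4 * a2\<^sup>2) < real ((a1 + 3)\<^sup>2 * a3)" by (simp only: of_nat_less_iff)
      with 1 show ?thesis by (simp add: abc)
    next
      case 2
      then show ?thesis by (simp add: Sp_def abc)
    next
      case 3
      then have "real ((a1 - 3) * a2\<^sup>2) = real (4 * (a1 - 2)\<^sup>2 * a3)" by simp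
      then have "(a - 3) * b\<^sup>2 = 4 * c * (a - 2)\<^sup>2"
        using a1_ge by (simp add: abc of_nat_diff)
      with 3 show ?thesis by simp
    qed simp
  next
    case False
    then have "(a - 1) * (a - 9) \<ge> 0" by (simp add: abc)
    then have "16 * a \<le> (a + 3)\<^sup>2" by (simp add: algebra_simps power2_eq_square)
    then have "16 * a * c \<le> (a + 3)\<^sup>2 * c" using c1 by simp
    then show ?thesis using lt False by (simp add: abc)
  qed
  \<comment> \<open>The threshold of (b) lies below that of (d), because
    \<open>(a - 3) * (2 * a - 3)^2\<close> is less than \<open>4 * (a - 2)^3\<close> by
    \<open>3 * a - 5\<close>. So (a), (b) and (c) all reduce to one strict inequality.\<close>
  have le_ab: "(a - 3) * b\<^sup>2 < 4 * c * (a - 2)\<^sup>2" if "(a - 2) * b\<^sup>2 \<le> c * (2 * a - 3)\<^sup>2"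
  proof -
    have "(a - 3) * ((a - 2) * b\<^sup>2) \<le> (a - 3) * (c * (2 * a - 3)\<^sup>2)"
      using that a4 by (intro mult_left_mono) auto
    also have "\<dots> = (a - 2) * (4 * c * (a - 2)\<^sup>2) - c * (3 * a - 5)"
      by (simp add: algebra_simps power2_eq_square)
    also have "\<dots> < (a - 2) * (4 * c * (a - 2)\<^sup>2)"
      using a4 c1 by simp
    finally have "(a - 2) * ((a - 3) * b\<^sup>2) < (a - 2) * (4 * c * (a - 2)\<^sup>2)"
      by (simp add: algebra_simps)
    then show ?thesis using a4 by simp
  qed
  \<comment> \<open>The exceptional polynomial lies on the threshold of (b), and hence off the
    threshold of (d).\<close>
  have Sp_ab: "(a - 2) * b\<^sup>2 = c * (2 * a - 3)\<^sup>2" if Sp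
    using that by (auto simp: Sp_def algebra_simps power2_eq_square)
  have a2_pos: "a - 2 > 0" "a - 3 > 0" using a4 by auto
  have exc: "(a - 3) * b\<^sup>2 > 4 * c * (a - 2)\<^sup>2" if "(a1, a2, a3) \<in> {(7, 9, 3), (8, 11, 4)}"
    using that by (auto simp: abc)
  have both: "\<not> connected A \<and> \<not> totally_disconnected A"
    if "b\<^sup>2 < 4 * a * c" "(a - 3) * b\<^sup>2 < 4 * c * (a - 2)\<^sup>2"
    using main[OF that(1)] that(2) exc disc ntd by linarith
  show ?thesis
    unfolding A(1) abc[symmetric]
  proof (intro conjI impI; (elim conjE)?)
    assume lt: "b\<^sup>2 < 4 * a * c"
    show "\<not> connected A" "\<not> totally_disconnected A" if "b\<^sup>2 < c * (2 * a - 3)\<^sup>2 / (a - 2)"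
      using both[OF lt le_ab] that a2_pos by (simp_all add: field_simps)
    show "\<not> connected A" "\<not> totally_disconnected A" if "b\<^sup>2 = c * (2 * a - 3)\<^sup>2 / (a - 2)"
      using both[OF lt le_ab] that a2_pos by (simp_all add: field_simps)
    show "\<not> connected A" "\<not> totally_disconnected A" if "b\<^sup>2 < 4 * c * (a - 2)\<^sup>2 / (a - 3)"
      using both[OF lt] that a2_pos by (simp_all add: field_simps)
    show "\<not> connected A"
      if "4 * c * (a - 2)\<^sup>2 / (a - 3) < b\<^sup>2" "(a1, a2, a3) \<notin> {(7, 9, 3), (8, 11, 4)}"
    proof -
      have "(a - 3) * b\<^sup>2 > 4 * c * (a - 2)\<^sup>2"
        using that(1) a2_pos by (simp add: field_simps)
      then show ?thesis
        using main[OF lt] that(2) disc by auto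
    qed
    assume eq: "b\<^sup>2 = 4 * c * (a - 2)\<^sup>2 / (a - 3)"
    then have eq': "(a - 3) * b\<^sup>2 = 4 * c * (a - 2)\<^sup>2"
      using a2_pos by simp
    show "connected A" if "a1 \<le> 7"
    proof -
      have "\<not> Sp" using Sp_ab le_ab eq' by fastforce
      then have "A = frontier K" using A(3) by blast
      \<comment> \<open>With \<open>b^2\<close> on the threshold of (d) the difference of the two
        sides factors through \<open>7 - a\<close>; the cofactor \<open>(a - 3)^2 + 4\<close> is
        positive. This is the origin of the bound 7.\<close>
      moreover have "(a - 3) * (4 * b\<^sup>2) \<ge> (a - 3) * ((a + 3)\<^sup>2 * c)"
      proof -
        have "(7 - a) * ((a - 3)\<^sup>2 + 4) \<ge> 0" using that by (simp add: abc)
        then have "c * ((7 - a) * ((a - 3)\<^sup>2 + 4)) \<ge> 0" using c1 by simp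
        moreover have "4 * (4 * c * (a - 2)\<^sup>2) - (a - 3) * ((a + 3)\<^sup>2 * c) = c * ((7 - a) * ((a - 3)\<^sup>2 + 4))"
          by (simp add: algebra_simps power2_eq_square)
        ultimately show ?thesis using eq' by simp
      qed
      then have "4 * b\<^sup>2 \<ge> (a + 3)\<^sup>2 * c" using a2_pos by simp
      ultimately show ?thesis using connected_frontier lt by simp
    qed
    show "\<not> connected A" "\<not> totally_disconnected A" if "a1 > 7"
      using main[OF lt] that exc eq' disc ntd by auto
  next
    assume eq: "b\<^sup>2 = 4 * a * c"
    have "\<not> Sp"
    proof
      assume Sp
      then have "(2 * c + 1)\<^sup>2 = 4 * (c + 2) * c" using eq by (simp add: Sp_def)
      then have "4 * c = 1" by (simp add: algebra_simps power2_eq_square)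
      then show False using c1 by simp
    qed
    then have AK: "A = frontier K" using A(3) by blast
    show "connected A" if "a1 \<le> 9"
    proof -
      \<comment> \<open>This product equals \<open>16 * a - (a + 3)^2\<close>, which is the origin
        of the bound 9.\<close>
      have "(a - 1) * (9 - a) \<ge> 0" using that a4 by (simp add: abc)
      then have "16 * a \<ge> (a + 3)\<^sup>2" by (simp add: algebra_simps power2_eq_square)
      then have "16 * a * c \<ge> (a + 3)\<^sup>2 * c" using c1 by simp
      then show ?thesis unfolding AK using eq by (intro connected_frontier) auto
    qed
    show "totally_disconnected A" if "a1 > 9"
      unfolding AK using eq that by (intro totally_disconnected_frontier) (auto simp: abc)
  next
    assume "4 * a * c < b\<^sup>2"
    then show "\<not> connected A" using disc by blast
  qed
qed

end
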